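(* Let $X$ be a separable real infinite-dimensional Banach space that contains an infinite-dimensional closed subspace with the Radon–Nikodým property. If $F \subset X$ is a bounded closed convex body with $0 \in \mathrm{int}\,F$, then the set $w^*\text{-}\exp F^\circ$ of all $w^*$-exposed points of the polar $F^\circ$ is uncountable.
   Context: The polar of $F$ is $F^\circ = \{f \in X^* : f(x) \leq 1 \text{ for all } x \in F\}$. A point $f$ of a set $A \subset X^*$ is a $w^*$-exposed point of $A$ if there is $x \in X$ such that $f(x) > g(x)$ for every $g \in A$ with $g \neq f$. A body is a set with non-empty (norm) interior. *)

theory Defs
  imports "HOL-Analysis.Analysis"
begin

definition infinite_dimensional :: "'a::real_vector set \<Rightarrow> bool" where
  "infinite_dimensional V \<longleftrightarrow> (\<nexists>B. finite B \<and> span B = V)"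

text \<open>
  Vector measures are total functions on sets; only their values on \<open>sets M\<close> matter.
\<close>

definition vector_measure :: "'b measure \<Rightarrow> ('b set \<Rightarrow> 'a::real_normed_vector) \<Rightarrow> bool" where
  "vector_measure M G \<longleftrightarrow>
    (\<forall>A :: nat \<Rightarrow> 'b set. range A \<subseteq> sets M \<longrightarrow> disjoint_family A \<longrightarrow>
      (\<lambda>n. G (A n)) sums G (\<Union>n. A n))"

definition continuous_wrt_measure :: "'b measure \<Rightarrow> ('b set \<Rightarrow> 'a::real_normed_vector) \<Rightarrow> bool" where
  "continuous_wrt_measure M G \<longleftrightarrow>
    (\<forall>\<epsilon>>0. \<exists>\<delta>>0. \<forall>E\<in>sets M. measure M E < \<delta> \<longrightarrow> norm (G E) < \<epsilon>)"

definition bounded_variation_wrt :: "'b measure \<Rightarrow> ('b set \<Rightarrow> 'a::real_normed_vector) \<Rightarrow> bool" where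
  "bounded_variation_wrt M G \<longleftrightarrow>
    (\<exists>C::real. \<forall>P. finite P \<longrightarrow> P \<subseteq> sets M \<longrightarrow> partition_on (space M) P \<longrightarrow>
      (\<Sum>E\<in>P. norm (G E)) \<le> C)"

text \<open>
  The Radon--Nikodym property of a closed subspace \<open>Y\<close>, in its measure-theoretic form.
  A definition cannot quantify over types, so the measure spaces are those carried by
  subsets of \<open>\<real>\<close>, with arbitrary \<open>\<sigma>\<close>-algebras. No generality is lost: the property for
  Lebesgue measure on \<open>[0,1]\<close> already implies it for every finite measure space. Since the ambient
  space is separable, this can also be seen directly: choose countably many functionals \<open>x\<^sub>n\<close>
  that separate points, let \<open>h\<^sub>n\<close> be the scalar density of \<open>x\<^sub>n \<circ> G\<close>, transport the measures along
  \<open>h = (h\<^sub>n)\<close> to a Borel subset of \<open>\<real>\<close>, and pull the density found there back along \<open>h\<close>.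
\<close>

definition radon_nikodym_property :: "'a::{banach, second_countable_topology} set \<Rightarrow> bool" where
  "radon_nikodym_property Y \<longleftrightarrow>
    (\<forall>(M :: real measure) (G :: real set \<Rightarrow> 'a).
      finite_measure M \<longrightarrow> (\<forall>E\<in>sets M. G E \<in> Y) \<longrightarrow> vector_measure M G \<longrightarrow>
      continuous_wrt_measure M G \<longrightarrow> bounded_variation_wrt M G \<longrightarrow>
      (\<exists>g. integrable M g \<and> (\<forall>\<omega>\<in>space M. g \<omega> \<in> Y) \<and>
        (\<forall>E\<in>sets M. G E = (LINT \<omega>:E|M. g \<omega>))))"

definition polar :: "'a::real_normed_vector set \<Rightarrow> ('a \<Rightarrow>\<^sub>L real) set" where
  "polar F = {f. \<forall>x\<in>F. blinfun_apply f x \<le> 1}"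

definition weak_star_exposed :: "('a::real_normed_vector \<Rightarrow>\<^sub>L real) set \<Rightarrow> ('a \<Rightarrow>\<^sub>L real) set" where
  "weak_star_exposed A =
    {f \<in> A. \<exists>x. \<forall>g\<in>A. g \<noteq> f \<longrightarrow> blinfun_apply f x > blinfun_apply g x}"

end

theory Submission
  imports Defs "HOL-Complex_Analysis.Great_Picard"
begin

text \<open>
  Let \<open>K\<close> be the polar of \<open>F\<close> and \<open>\<theta> f = (\<Sum>k. f(v\<^sub>k)\<^sup>2 / 2\<^sup>k)\<close> for a sequence \<open>v\<close> in the unit ball that
  separates functionals. For each \<open>x\<close> the weak* continuous, strictly convex function
  \<open>f \<mapsto> f x + \<theta> f\<close> attains its maximum over \<open>K\<close>, and every maximizer is a weak* exposed point.
  If these are only countably many, \<open>f\<^sub>0, f\<^sub>1, \<dots>\<close>, then the function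
  \<open>x \<mapsto> sup\<^sub>n (f\<^sub>n x + \<theta> f\<^sub>n + 1/(n+1))\<close> is locally a maximum of finitely many affine functions, so
  a sublevel set \<open>C\<close> of it in \<open>Y\<close> is bounded, and each of its points \<open>x\<close> admits perturbations
  \<open>x \<plusminus> v\<close> within \<open>C\<close> whose size is locally bounded below. Iterating almost maximal perturbations
  gives a bounded dyadic martingale in \<open>C\<close>. By the Radon--Nikodym property it converges in \<open>L\<^sup>1\<close>, so
  its increments tend to zero; but near a value of the limit they are bounded below.
\<close>

subsection \<open>Norming functionals\<close>

definition sublinear :: "('a::real_vector \<Rightarrow> real) \<Rightarrow> bool" where
  "sublinear q \<longleftrightarrow> (\<forall>x y. q (x + y) \<le> q x + q y) \<and> (\<forall>t\<ge>0. \<forall>x. q (t *\<^sub>R x) = t * q x)"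

lemma sublinearD:
  assumes "sublinear q"
  shows "q (x + y) \<le> q x + q y" and "t \<ge> 0 \<Longrightarrow> q (t *\<^sub>R x) = t * q x"
    and "q 0 = 0" and "- q (- x) \<le> q x"
proof -
  show add: "q (x + y) \<le> q x + q y" for x y
    using assms by (auto simp: sublinear_def)
  show scale: "t \<ge> 0 \<Longrightarrow> q (t *\<^sub>R x) = t * q x" for t x
    using assms by (auto simp: sublinear_def)
  show zero: "q 0 = 0"
    using scale[of 0 0] by simp
  show "- q (- x) \<le> q x"
    using add[of x "- x"] zero by simp
qed

text \<open>
  A minimal sublinear functional \<open>q\<close> equals all its tilts, and \<open>tilt u q (- u) \<le> - q u\<close>; hence \<open>q\<close> is linear.
\<close>

definition tilt :: "'a::real_vector \<Rightarrow> ('a \<Rightarrow> real) \<Rightarrow> 'a \<Rightarrow> real" where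
  "tilt u q y = (INF t\<in>{0..}. q (y + t *\<^sub>R u) - t * q u)"

text \<open>Subadditivity for \<open>t *\<^sub>R u = (y + t *\<^sub>R u) + (- y)\<close>. The bound
  is free of \<open>t\<close>, so the infimum that defines \<open>tilt\<close> is taken over a set
  bounded below.\<close>

lemma tilt_lower:
  assumes q: "sublinear q" and t: "t \<ge> 0"
  shows "- q (- y) \<le> q (y + t *\<^sub>R u) - t * q u"
  using sublinearD(1)[OF q, of "y + t *\<^sub>R u" "- y"] sublinearD(2)[OF q t, of u] by simp

lemma tilt_le:
  assumes q: "sublinear q" and t: "t \<ge> 0"
  shows "tilt u q y \<le> q (y + t *\<^sub>R u) - t * q u"
  unfolding tilt_def
  by (rule cINF_lower) (use tilt_lower[OF q] t in \<open>auto intro!: bdd_belowI2\<close>)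

lemma tilt_ge:
  assumes "\<And>t. t \<ge> 0 \<Longrightarrow> c \<le> q (y + t *\<^sub>R u) - t * q u"
  shows "c \<le> tilt u q y"
  unfolding tilt_def by (rule cINF_greatest) (use assms in auto)

text \<open>Parameters \<open>s\<close> for \<open>x\<close> and \<open>t\<close> for
  \<open>y\<close> combine to \<open>s + t\<close> for \<open>x + y\<close>. Scaling the argument by
  \<open>t > 0\<close> amounts to substituting \<open>t * s\<close> for \<open>s\<close> in the
  infimum; for \<open>t = 0\<close> the value \<open>tilt u q 0 = 0\<close> is needed.\<close>

lemma sublinear_tilt:
  assumes q: "sublinear q"
  shows "sublinear (tilt u q)"
  unfolding sublinear_def
proof (intro conjI allI impI)
  fix x y
  have "tilt u q (x + y) - (q (x + s *\<^sub>R u) - s * q u) \<le> tilt u q y" if s: "s \<ge> 0" for s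
  proof (rule tilt_ge)
    fix t :: real assume t: "t \<ge> 0"
    have "q (x + y + (s + t) *\<^sub>R u) \<le> q (x + s *\<^sub>R u) + q (y + t *\<^sub>R u)"
      using sublinearD(1)[OF q, of "x + s *\<^sub>R u" "y + t *\<^sub>R u"] by (simp add: algebra_simps)
    with tilt_le[OF q, of "s + t" u "x + y"] s t
    show "tilt u q (x + y) - (q (x + s *\<^sub>R u) - s * q u) \<le> q (y + t *\<^sub>R u) - t * q u"
      by (simp add: algebra_simps)
  qed
  then have "tilt u q (x + y) - tilt u q y \<le> tilt u q x"
    by (intro tilt_ge) (smt (verit))
  then show "tilt u q (x + y) \<le> tilt u q x + tilt u q y" by simp
next
  fix t :: real and x assume t: "t \<ge> 0"
  show "tilt u q (t *\<^sub>R x) = t * tilt u q x"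
  proof (cases "t = 0")
    case True
    have "tilt u q 0 \<le> 0" using tilt_le[OF q, of 0 u 0] sublinearD(3)[OF q] by simp
    moreover have "0 \<le> tilt u q 0"
      by (rule tilt_ge) (use sublinearD[OF q] in simp)
    ultimately show ?thesis using True by simp
  next
    case False
    with t have t: "t > 0" by simp
    have eq: "q (t *\<^sub>R x + (t * s) *\<^sub>R u) - t * s * q u = t * (q (x + s *\<^sub>R u) - s * q u)" for s
      using sublinearD(2)[OF q, of t "x + s *\<^sub>R u"] t by (simp add: algebra_simps)
    have "tilt u q (t *\<^sub>R x) / t \<le> tilt u q x"
    proof (rule tilt_ge)
      fix s :: real assume "s \<ge> 0"
      then show "tilt u q (t *\<^sub>R x) / t \<le> q (x + s *\<^sub>R u) - s * q u"
        using tilt_le[OF q, of "t * s" u "t *\<^sub>R x"] eq[of s] t by (simp add: field_simps)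
    qed
    moreover have "t * tilt u q x \<le> tilt u q (t *\<^sub>R x)"
    proof (rule tilt_ge)
      fix s :: real assume "s \<ge> 0"
      then show "t * tilt u q x \<le> q (t *\<^sub>R x + s *\<^sub>R u) - s * q u"
        using tilt_le[OF q, of "s / t" u x] eq[of "s / t"] t mult_left_mono[of "tilt u q x" _ t] by fastforce
    qed
    ultimately show ?thesis using t by (simp add: field_simps)
  qed
qed

lemma tilt_le_self: "sublinear q \<Longrightarrow> tilt u q \<le> q"
  unfolding le_fun_def using tilt_le[of q 0] by simp

lemma tilt_uminus: "sublinear q \<Longrightarrow> tilt u q (- u) \<le> - q u"
  using tilt_le[of q 1 u "- u"] sublinearD(3)[of q] by simp

text \<open>The common majorant \<open>p\<close> bounds all members below by
  \<open>- p (- x)\<close>, so pointwise infima are finite. Subadditivity survives because of two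
  members of a chain one is the smaller, and this one estimates both summands at once.\<close>

lemma sublinear_Inf_chain:
  assumes C: "\<And>q. q \<in> C \<Longrightarrow> sublinear q" and le: "\<And>q. q \<in> C \<Longrightarrow> q \<le> p"
    and chain: "\<And>q r. q \<in> C \<Longrightarrow> r \<in> C \<Longrightarrow> q \<le> r \<or> r \<le> q" and ne: "C \<noteq> {}"
  shows "sublinear (\<lambda>x. INF q\<in>C. q x)" and "\<And>q. q \<in> C \<Longrightarrow> (\<lambda>x. INF q\<in>C. q x) \<le> q"
proof -
  let ?m = "\<lambda>x. INF q\<in>C. q x"
  have lower: "- p (- x) \<le> q x" if "q \<in> C" for q x
    using sublinearD(4)[OF C[OF that], of x] le[OF that] unfolding le_fun_def by (smt (verit))
  have bdd: "bdd_below ((\<lambda>q. q x) ` C)" for x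
    using lower by (auto intro!: bdd_belowI2)
  have m_le: "?m x \<le> q x" if "q \<in> C" for q x
    by (rule cINF_lower[OF bdd that])
  then show "\<And>q. q \<in> C \<Longrightarrow> ?m \<le> q" by (simp add: le_fun_def)
  have m_ge: "c \<le> ?m x" if "\<And>q. q \<in> C \<Longrightarrow> c \<le> q x" for c x
    using that ne by (intro cINF_greatest) auto
  show "sublinear ?m"
    unfolding sublinear_def
  proof (intro conjI allI impI)
    fix x y
    have "?m (x + y) - q x \<le> ?m y" if q: "q \<in> C" for q
    proof (rule m_ge)
      fix r assume r: "r \<in> C"
      obtain s where s: "s \<in> C" "s \<le> q" "s \<le> r"
        using chain[OF q r] q r by auto
      have "?m (x + y) \<le> s x + s y"
        using m_le[OF s(1), of "x + y"] sublinearD(1)[OF C[OF s(1)], of x y] by linarith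
      also have "\<dots> \<le> q x + r y"
        using s by (intro add_mono) (auto simp: le_fun_def)
      finally show "?m (x + y) - q x \<le> r y" by simp
    qed
    then have "?m (x + y) - ?m y \<le> ?m x"
      by (intro m_ge) (smt (verit))
    then show "?m (x + y) \<le> ?m x + ?m y" by simp
  next
    fix t :: real and x assume t: "t \<ge> 0"
    show "?m (t *\<^sub>R x) = t * ?m x"
    proof (cases "t = 0")
      case True
      have "(\<lambda>q. q 0) ` C = {0}"
        using sublinearD(3)[OF C] ne by force
      with True show ?thesis by simp
    next
      case False
      with t have t: "t > 0" by simp
      have "t * ?m x \<le> ?m (t *\<^sub>R x)"
      proof (rule m_ge)
        fix q assume "q \<in> C"
        then show "t * ?m x \<le> q (t *\<^sub>R x)"
          using m_le[of q x] sublinearD(2)[OF C, of q t x] t by simp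
      qed
      moreover have "?m (t *\<^sub>R x) / t \<le> ?m x"
      proof (rule m_ge)
        fix q assume "q \<in> C"
        then show "?m (t *\<^sub>R x) / t \<le> q x"
          using m_le[of q "t *\<^sub>R x"] sublinearD(2)[OF C, of q t x] t by (simp add: field_simps)
      qed
      ultimately show ?thesis using t by (simp add: field_simps)
    qed
  qed
qed

text \<open>Zorn's lemma for the reversed pointwise order: a nonempty chain is bounded by its
  pointwise infimum, the empty chain by \<open>p\<close>.\<close>

lemma minimal_sublinear_exists:
  assumes p: "sublinear p"
  obtains q where "sublinear q" "q \<le> p" "\<And>r. sublinear r \<Longrightarrow> r \<le> q \<Longrightarrow> r = q"
proof -
  let ?A = "{q. sublinear q \<and> q \<le> p}"
  have "\<exists>m\<in>?A. \<forall>a\<in>?A. m \<ge> a \<longrightarrow> a = m"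
  proof (rule predicate_Zorn)
    show "partial_order_on ?A (relation_of (\<ge>) ?A)"
      unfolding partial_order_on_def preorder_on_def relation_of_def
      by (auto simp: refl_on_def trans_def antisym_def)
    fix C assume "C \<in> Chains (relation_of (\<ge>) ?A)"
    then have C: "\<And>q. q \<in> C \<Longrightarrow> sublinear q" "\<And>q. q \<in> C \<Longrightarrow> q \<le> p"
      and chain: "\<And>q r. q \<in> C \<Longrightarrow> r \<in> C \<Longrightarrow> q \<le> r \<or> r \<le> q"
      unfolding Chains_def relation_of_def by blast+
    show "\<exists>u\<in>?A. \<forall>a\<in>C. u \<le> a"
    proof (cases "C = {}")
      case True
      then show ?thesis using p by auto
    next
      case False
      note inf = sublinear_Inf_chain[OF C chain False]
      from False obtain q where "q \<in> C" by auto
      with inf(2) C(2) have "(\<lambda>x. INF q\<in>C. q x) \<le> p" by (meson order_trans)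
      with inf show ?thesis by blast
    qed
  qed
  then show thesis using that by (auto intro: order_trans)
qed

text \<open>A case of the Hahn-Banach theorem. The minimal functional is sought below
  \<open>tilt x norm\<close> instead of \<open>norm\<close>, because
  \<open>tilt x norm (- x) \<le> - norm x\<close> then forces the value \<open>norm x\<close> at
  \<open>x\<close>.\<close>

theorem norming_functional:
  fixes x :: "'a::real_normed_vector"
  obtains f :: "'a \<Rightarrow>\<^sub>L real" where "norm f \<le> 1" "blinfun_apply f x = norm x"
proof -
  have p: "sublinear (norm :: 'a \<Rightarrow> real)"
    by (auto simp: sublinear_def norm_triangle_ineq)
  obtain q where q: "sublinear q" "q \<le> tilt x norm"
    and minimal: "\<And>r. sublinear r \<Longrightarrow> r \<le> q \<Longrightarrow> r = q"
    using minimal_sublinear_exists[OF sublinear_tilt[OF p]] by metis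
  have odd: "q (- u) = - q u" for u
  proof -
    have "tilt u q = q"
      by (rule minimal[OF sublinear_tilt[OF q(1)] tilt_le_self[OF q(1)]])
    then show ?thesis
      using tilt_uminus[OF q(1), of u] sublinearD(4)[OF q(1), of u] by simp
  qed
  have q_le: "q u \<le> norm u" for u
    using q(2) tilt_le_self[OF p, of x] unfolding le_fun_def by (meson order_trans)
  have "bounded_linear q"
  proof (rule bounded_linear_intro)
    show "q (u + v) = q u + q v" for u v
      using sublinearD(1)[OF q(1), of u v] sublinearD(1)[OF q(1), of "- u" "- v"] odd[of "u + v"]
      by (simp add: odd)
    show "q (t *\<^sub>R u) = t *\<^sub>R q u" for t u
      using sublinearD(2)[OF q(1), of t u] sublinearD(2)[OF q(1), of "- t" u] odd[of "t *\<^sub>R u"]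
      by (cases "t \<ge> 0") auto
    show "norm (q u) \<le> norm u * 1" for u
      using q_le[of u] q_le[of "- u"] odd[of u] by simp
  qed
  then have ap: "blinfun_apply (Blinfun q) = q"
    by (rule bounded_linear_Blinfun_apply)
  show thesis
  proof
    show "norm (Blinfun q) \<le> 1"
      by (rule norm_blinfun_bound) (use q_le q_le[of "- _"] odd ap in \<open>auto simp: abs_le_iff\<close>)
    have "q (- x) \<le> - norm x"
      using q(2) tilt_uminus[OF p, of x] unfolding le_fun_def by (meson order_trans)
    then show "blinfun_apply (Blinfun q) x = norm x"
      using odd[of x] q_le[of x] ap by simp
  qed
qed

subsection \<open>Weak* exposed points of a polar\<close>

text \<open>Dense vectors are moved into the unit ball without losing the values of functionals on
  them; the divisor \<open>1 + norm d\<close> is positive even for \<open>d = 0\<close>.\<close>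

lemma norm_normalize_le: "norm (d /\<^sub>R (1 + norm d)) \<le> 1"
  and blinfun_apply_normalize:
    "(1 + norm d) * blinfun_apply f (d /\<^sub>R (1 + norm d)) = blinfun_apply f (d :: 'a::real_normed_vector)"
proof -
  have "0 < 1 + norm d" using norm_ge_zero[of d] by linarith
  then show "norm (d /\<^sub>R (1 + norm d)) \<le> 1"
    and "(1 + norm d) * blinfun_apply f (d /\<^sub>R (1 + norm d)) = blinfun_apply f d"
    by (simp_all add: blinfun.scaleR_right divide_simps)
qed

text \<open>The sequential Banach-Alaoglu theorem for a separable space: a subsequence converges on
  a countable dense set, and the common Lipschitz constant \<open>L\<close> carries convergence over
  to every vector.\<close>

lemma weak_star_sequentially_compact:
  fixes g :: "nat \<Rightarrow> 'a::{real_normed_vector, second_countable_topology} \<Rightarrow>\<^sub>L real"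
  assumes L: "\<And>j. norm (g j) \<le> L"
  obtains s f where "strict_mono s" "\<And>x. (\<lambda>j. blinfun_apply (g (s j)) x) \<longlonglongrightarrow> blinfun_apply f x"
proof -
  obtain D :: "'a set" where D: "countable D" "\<And>X. open X \<Longrightarrow> X \<noteq> {} \<Longrightarrow> \<exists>d\<in>D. d \<in> X"
    using countable_dense_setE by blast
  \<comment> \<open>\<open>function_convergent_subsequence\<close> expects one bound valid at all
    points, which the scaled dense vectors provide.\<close>
  define v where "v d = d /\<^sub>R (1 + norm d)" for d :: 'a
  have L0: "0 \<le> L" using L[of 0] norm_ge_zero order_trans by blast
  have g_le: "\<bar>blinfun_apply (g j) x\<bar> \<le> L * norm x" for j x
    using norm_blinfun[of "g j" x] mult_right_mono[OF L[of j] norm_ge_zero[of x]] by simp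
  have v1: "norm (v d) \<le> 1" for d
    unfolding v_def by (rule norm_normalize_le)
  have "norm (blinfun_apply (g j) x) \<le> L" if "x \<in> v ` D" for j x
  proof -
    have "norm x \<le> 1" using that v1 by auto
    with g_le[of j x] L0 mult_left_mono[of "norm x" 1 L] show ?thesis by simp
  qed
  then obtain s where s: "strict_mono (s :: nat \<Rightarrow> nat)"
    "\<And>x. x \<in> v ` D \<Longrightarrow> \<exists>l. (\<lambda>j. blinfun_apply (g (s j)) x) \<longlonglongrightarrow> l"
    by (rule function_convergent_subsequence[of "v ` D" "\<lambda>j. blinfun_apply (g j)" L, OF countable_image[OF D(1)]]) blast+
  have convD: "convergent (\<lambda>j. blinfun_apply (g (s j)) d)" if d: "d \<in> D" for d
  proof -
    obtain l where "(\<lambda>j. blinfun_apply (g (s j)) (v d)) \<longlonglongrightarrow> l"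
      using s(2)[OF imageI[OF d]] by blast
    then have "(\<lambda>j. (1 + norm d) * blinfun_apply (g (s j)) (v d)) \<longlonglongrightarrow> (1 + norm d) * l"
      by (rule tendsto_mult_left)
    moreover have "(1 + norm d) * blinfun_apply (g (s j)) (v d) = blinfun_apply (g (s j)) d" for j
      unfolding v_def by (rule blinfun_apply_normalize)
    ultimately show ?thesis by (auto simp: convergent_def)
  qed
  have "Cauchy (\<lambda>j. blinfun_apply (g (s j)) x)" for x
  proof (rule metric_CauchyI)
    fix e :: real assume e: "e > 0"
    \<comment> \<open>Functionals of norm at most \<open>L\<close> vary by at most
      \<open>e / 3\<close> over the distance \<open>r\<close>; \<open>L + 1\<close> keeps the
      divisor positive when \<open>L = 0\<close>.\<close>
    define r where "r = e / (3 * (L + 1))"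
    have r: "r > 0" "L * r \<le> e / 3" using e L0 by (auto simp: r_def field_simps)
    obtain d where d: "d \<in> D" "d \<in> ball x r"
      using D(2)[of "ball x r"] r by auto
    obtain N where N: "\<And>i j. i \<ge> N \<Longrightarrow> j \<ge> N \<Longrightarrow>
        dist (blinfun_apply (g (s i)) d) (blinfun_apply (g (s j)) d) < e / 3"
      using convD[OF d(1)] e unfolding Cauchy_convergent_iff[symmetric] Cauchy_def
      by (metis divide_pos_pos zero_less_numeral)
    have near: "\<bar>blinfun_apply (g (s j)) x - blinfun_apply (g (s j)) d\<bar> \<le> e / 3" for j
    proof -
      have "\<bar>blinfun_apply (g (s j)) (x - d)\<bar> \<le> L * norm (x - d)" by (rule g_le)
      also have "\<dots> \<le> L * r" using d L0 by (intro mult_left_mono) (auto simp: dist_norm)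
      finally show ?thesis using r by (simp add: blinfun.diff_right)
    qed
    show "\<exists>N. \<forall>m\<ge>N. \<forall>n\<ge>N. dist (blinfun_apply (g (s m)) x) (blinfun_apply (g (s n)) x) < e"
    proof (intro exI allI impI)
      fix m n assume "N \<le> m" "N \<le> n"
      with N[of m n] near[of m] near[of n]
      show "dist (blinfun_apply (g (s m)) x) (blinfun_apply (g (s n)) x) < e"
        by (simp add: dist_real_def) (smt (verit) field_sum_of_halves)
    qed
  qed
  then have "\<forall>x. \<exists>l. (\<lambda>j. blinfun_apply (g (s j)) x) \<longlonglongrightarrow> l"
    by (simp add: Cauchy_convergent_iff convergent_def)
  then obtain h where h: "\<And>x. (\<lambda>j. blinfun_apply (g (s j)) x) \<longlonglongrightarrow> h x"
    by metis
  have "bounded_linear h"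
  proof (rule bounded_linear_intro)
    show "h (x + y) = h x + h y" for x y
      by (rule LIMSEQ_unique[OF h[of "x + y"]]) (unfold blinfun.add_right, intro tendsto_add h)
    show "h (t *\<^sub>R x) = t *\<^sub>R h x" for t x
      by (rule LIMSEQ_unique[OF h[of "t *\<^sub>R x"]])
        (unfold blinfun.scaleR_right, intro tendsto_scaleR tendsto_const h)
    show "norm (h x) \<le> norm x * L" for x
      using Lim_bounded[OF tendsto_norm[OF h[of x]]] g_le by (simp add: mult.commute)
  qed
  then have "blinfun_apply (Blinfun h) = h" by (rule bounded_linear_Blinfun_apply)
  with h s(1) that[of s "Blinfun h"] show thesis by simp
qed

section \<open>The strictly convex perturbation\<close>

definition quad :: "(nat \<Rightarrow> 'a::real_normed_vector) \<Rightarrow> ('a \<Rightarrow>\<^sub>L real) \<Rightarrow> real" where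
  "quad v f = (\<Sum>k. (1/2)^k * (blinfun_apply f (v k))\<^sup>2)"

context
  fixes v :: "nat \<Rightarrow> 'a::banach"
  assumes v1: "\<And>k. norm (v k) \<le> 1"
begin

lemma blinfun_apply_le_norm: "\<bar>blinfun_apply f (v k)\<bar> \<le> norm f"
  using norm_blinfun[of f "v k"] mult_left_mono[OF v1[of k] norm_ge_zero[of f]] by simp

text \<open>\<open>quad v\<close> is the function \<open>\<theta>\<close> of the introduction. Its
  terms are dominated by \<open>L\<^sup>2 * (1/2)^k\<close>, a geometric series with sum
  \<open>2 * L\<^sup>2\<close>.\<close>

lemma quad_bounds:
  assumes "norm f \<le> L"
  shows "summable (\<lambda>k. (1/2)^k * (blinfun_apply f (v k))\<^sup>2)" and "0 \<le> quad v f" and "quad v f \<le> 2 * L\<^sup>2"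
proof -
  have le: "(1/2)^k * (blinfun_apply f (v k))\<^sup>2 \<le> L\<^sup>2 * (1/2)^k" for k
  proof -
    have "(blinfun_apply f (v k))\<^sup>2 \<le> L\<^sup>2"
      using blinfun_apply_le_norm[of f k] assms by (intro abs_le_square_iff[THEN iffD1]) auto
    then show ?thesis by (simp add: mult.commute)
  qed
  have geo: "(\<lambda>k. L\<^sup>2 * (1/2)^k) sums (L\<^sup>2 * 2)"
    using sums_mult[OF geometric_sums[of "1/2 :: real"], of "L\<^sup>2"] by simp
  show sm: "summable (\<lambda>k. (1/2)^k * (blinfun_apply f (v k))\<^sup>2)"
    by (rule summable_comparison_test[OF _ sums_summable[OF geo]]) (use le in auto)
  show "0 \<le> quad v f" unfolding quad_def by (rule suminf_nonneg[OF sm]) simp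
  show "quad v f \<le> 2 * L\<^sup>2"
    unfolding quad_def using suminf_le[OF le sm sums_summable[OF geo]] sums_unique[OF geo] by simp
qed

text \<open>Weak* sequential continuity on bounded sets: each term converges, and the bound
  \<open>L\<^sup>2 * (1/2)^k\<close> is uniform in \<open>j\<close>, so Tannery's theorem exchanges
  limit and sum.\<close>

lemma tendsto_quad:
  assumes L: "\<And>j. norm (g j) \<le> L" and lim: "\<And>x. (\<lambda>j. blinfun_apply (g j) x) \<longlonglongrightarrow> blinfun_apply f x"
  shows "(\<lambda>j. quad v (g j)) \<longlonglongrightarrow> quad v f"
proof -
  have "(blinfun_apply (g j) (v k))\<^sup>2 \<le> L\<^sup>2" for j k
    using blinfun_apply_le_norm[of "g j" k] L[of j] by (intro abs_le_square_iff[THEN iffD1]) auto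
  then have "\<forall>\<^sub>F (k, j) in at_top \<times>\<^sub>F sequentially.
      norm ((1/2)^k * (blinfun_apply (g j) (v k))\<^sup>2) \<le> L\<^sup>2 * (1/2)^k"
    by (intro always_eventually) (auto simp: mult.commute abs_mult)
  moreover have "summable (\<lambda>k. L\<^sup>2 * (1/2 :: real)^k)"
    by (intro summable_mult summable_geometric) simp
  ultimately show ?thesis
    unfolding quad_def
    by (intro tannerys_theorem[where M = "\<lambda>k. L\<^sup>2 * (1/2)^k", THEN conjunct2, THEN conjunct2])
      (auto intro!: tendsto_mult_left tendsto_power lim)
qed

text \<open>
  Since \<open>quad v\<close> is strictly convex, replacing it by its tangent functional at \<open>f\<close>, which is
  evaluation at the vector \<open>a\<close> below, turns a maximizer into the unique one.
\<close>

lemma maximizer_weak_star_exposed: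
  assumes sep: "\<And>f g :: 'a \<Rightarrow>\<^sub>L real. (\<And>k. blinfun_apply f (v k) = blinfun_apply g (v k)) \<Longrightarrow> f = g"
    and f: "f \<in> A" and max: "\<And>g. g \<in> A \<Longrightarrow> blinfun_apply g x + quad v g \<le> blinfun_apply f x + quad v f"
  shows "f \<in> weak_star_exposed A"
proof -
  \<comment> \<open>The derivative at \<open>f\<close> of the \<open>k\<close>-th term of
    \<open>quad v\<close> in the direction \<open>g\<close> is
    \<open>blinfun_apply g (u k)\<close>.\<close>
  define u where "u k = (2 * (1/2)^k * blinfun_apply f (v k)) *\<^sub>R v k" for k
  define a where "a = (\<Sum>k. u k)"
  have "norm (u k) \<le> 2 * norm f * (1/2)^k" for k
    using mult_mono[OF blinfun_apply_le_norm[of f k] v1[of k]] by (simp add: u_def abs_mult)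
  moreover have "summable (\<lambda>k. 2 * norm f * (1/2 :: real)^k)"
    by (intro summable_mult summable_geometric) simp
  ultimately have u: "summable u"
    using summable_comparison_test'[of "\<lambda>k. 2 * norm f * (1/2)^k" 0 u] by blast
  have apply_a: "(\<lambda>k. 2 * (1/2)^k * blinfun_apply f (v k) * blinfun_apply g (v k)) sums blinfun_apply g a" for g
  proof -
    have "blinfun_apply g (u k) = 2 * (1/2)^k * blinfun_apply f (v k) * blinfun_apply g (v k)" for k
      by (simp add: u_def blinfun.scaleR_right)
    then show ?thesis
      using bounded_linear.sums[OF blinfun.bounded_linear_right[of g] summable_sums[OF u]]
      by (simp add: a_def)
  qed
  have "blinfun_apply g (x + a) < blinfun_apply f (x + a)" if g: "g \<in> A" "g \<noteq> f" for g
  proof -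
    let ?d = "\<lambda>k. (1/2)^k * (blinfun_apply g (v k) - blinfun_apply f (v k))\<^sup>2"
    have sm: "summable ?d"
      using quad_bounds(1)[of "g - f" "norm (g - f)"] by (simp add: blinfun.diff_left)
    obtain k where "blinfun_apply g (v k) \<noteq> blinfun_apply f (v k)"
      using sep g(2) by metis
    then have "0 < suminf ?d"
      by (intro suminf_pos2[OF sm, of k]) auto
    \<comment> \<open>Termwise
      \<open>p\<^sup>2 - q\<^sup>2 - 2 * q * (p - q) = (p - q)\<^sup>2\<close>: the gap between
      \<open>quad v\<close> and its tangent at \<open>f\<close> is a sum of squares, positive by
      separation.\<close>
    moreover have "quad v g - quad v f - (blinfun_apply g a - blinfun_apply f a) = suminf ?d"
    proof (rule sums_unique)
      have quad: "(\<lambda>k. (1/2)^k * (blinfun_apply h (v k))\<^sup>2) sums quad v h" for h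
        unfolding quad_def by (rule summable_sums[OF quad_bounds(1)[OF order_refl]])
      show "?d sums (quad v g - quad v f - (blinfun_apply g a - blinfun_apply f a))"
        using sums_diff[OF sums_diff[OF quad[of g] quad[of f]] sums_diff[OF apply_a[of g] apply_a[of f]]]
        by (rule sums_cong[THEN iffD1, rotated]) (simp add: power2_eq_square algebra_simps)
    qed
    ultimately show ?thesis
      using max[OF g(1)] by (simp add: blinfun.add_right)
  qed
  with f show ?thesis by (auto simp: weak_star_exposed_def)
qed

end

section \<open>Maximizers over the polar\<close>

lemma polar_norm_le:
  assumes "r > 0" "cball 0 r \<subseteq> F" "f \<in> polar F"
  shows "norm f \<le> 1 / r"
proof (rule norm_blinfun_bound)
  show "norm (blinfun_apply f x) \<le> 1 / r * norm x" for x
  proof (cases "x = 0")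
    case False
    have "blinfun_apply f y \<le> 1" if "norm y = r" for y
      using that assms by (auto simp: polar_def)
    \<comment> \<open>The multiples of \<open>x\<close> of norm \<open>r\<close>, with both signs,
      bound the absolute value.\<close>
    from this[of "(r / norm x) *\<^sub>R x"] this[of "(- r / norm x) *\<^sub>R x"] False assms(1)
    show ?thesis by (simp add: blinfun.scaleR_right blinfun.minus_right abs_le_iff field_simps)
  qed (simp add: blinfun.zero_right)
qed (use assms in simp)

text \<open>The set where \<open>f - g\<close> does not vanish is open, so if it avoids a dense set
  it is empty. Scaling the dense vectors by positive factors does not affect vanishing.\<close>

lemma separating_sequence_exists:
  obtains v :: "nat \<Rightarrow> 'a::{real_normed_vector, second_countable_topology}"
  where "\<And>k. norm (v k) \<le> 1"
    and "\<And>f g :: 'a \<Rightarrow>\<^sub>L real. (\<And>k. blinfun_apply f (v k) = blinfun_apply g (v k)) \<Longrightarrow> f = g"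
proof -
  obtain D :: "'a set" where D: "countable D" "\<And>X. open X \<Longrightarrow> X \<noteq> {} \<Longrightarrow> \<exists>d\<in>D. d \<in> X"
    using countable_dense_setE by blast
  have "D \<noteq> {}" using D(2)[of UNIV] by auto
  define w where "w = from_nat_into D"
  have w: "range w = D" unfolding w_def by (rule range_from_nat_into[OF \<open>D \<noteq> {}\<close> D(1)])
  define v where "v k = w k /\<^sub>R (1 + norm (w k))" for k
  show thesis
  proof (rule that[of v])
    show "norm (v k) \<le> 1" for k
      unfolding v_def by (rule norm_normalize_le)
    fix f g :: "'a \<Rightarrow>\<^sub>L real"
    assume eq: "\<And>k. blinfun_apply f (v k) = blinfun_apply g (v k)"
    have "blinfun_apply (f - g) (w k) = 0" for k
      using eq[of k] blinfun_apply_normalize[of "w k" f] blinfun_apply_normalize[of "w k" g]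
      by (simp add: v_def blinfun.diff_left)
    then have zero: "blinfun_apply (f - g) d = 0" if "d \<in> D" for d
      using that w by auto
    have op: "open {x. blinfun_apply (f - g) x \<noteq> 0}"
      by (intro open_Collect_neq continuous_intros)
    have "{x. blinfun_apply (f - g) x \<noteq> 0} = {}"
      using D(2)[OF op] zero by auto
    then have "f - g = 0" by (intro blinfun_eqI) auto
    then show "f = g" by simp
  qed
qed

text \<open>The direct method: a maximizing sequence in the bounded polar has a weak* convergent
  subsequence, the polar is closed under such limits, and the objective is weak* sequentially
  continuous.\<close>

lemma polar_maximizer_exists:
  fixes v :: "nat \<Rightarrow> 'a::{banach, second_countable_topology}"
  assumes v1: "\<And>k. norm (v k) \<le> 1" and L: "\<And>f. f \<in> polar F \<Longrightarrow> norm f \<le> L"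
  obtains f where "f \<in> polar F"
    "\<And>g. g \<in> polar F \<Longrightarrow> blinfun_apply g x + quad v g \<le> blinfun_apply f x + quad v f"
proof -
  let ?V = "\<lambda>g. blinfun_apply g x + quad v g"
  have "0 \<in> polar F" by (simp add: polar_def)
  have "?V g \<le> L * norm x + 2 * L\<^sup>2" if "g \<in> polar F" for g
    using norm_blinfun[of g x] mult_right_mono[OF L[OF that] norm_ge_zero[of x]]
      quad_bounds(3)[of v, OF v1 L[OF that]] by simp
  then have bdd: "bdd_above (?V ` polar F)" by (auto intro!: bdd_aboveI2)
  define S where "S = (SUP g\<in>polar F. ?V g)"
  have "\<exists>g\<in>polar F. S - 1 / (real j + 1) < ?V g" for j
    using less_cSUP_iff[OF _ bdd, of "S - 1 / (real j + 1)"] \<open>0 \<in> polar F\<close> by (auto simp: S_def)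
  then obtain g where g: "\<And>j. g j \<in> polar F" "\<And>j. S - 1 / (real j + 1) < ?V (g j)"
    by metis
  obtain s f where s: "strict_mono s"
    and lim: "\<And>y. (\<lambda>j. blinfun_apply (g (s j)) y) \<longlonglongrightarrow> blinfun_apply f y"
    using weak_star_sequentially_compact[of g L] L g(1) by metis
  have "f \<in> polar F"
    using Lim_bounded[OF lim] g(1) by (fastforce simp: polar_def)
  moreover have "S \<le> ?V f"
  proof (rule LIMSEQ_le)
    have "(\<lambda>j. S - 1 / (real j + 1)) \<longlonglongrightarrow> S - 0"
      using LIMSEQ_inverse_real_of_nat by (intro tendsto_intros) (simp add: inverse_eq_divide add.commute)
    then show "(\<lambda>j. S - 1 / (real (s j) + 1)) \<longlonglongrightarrow> S"
      using LIMSEQ_subseq_LIMSEQ[OF _ s] by (fastforce simp: o_def)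
    show "(\<lambda>j. ?V (g (s j))) \<longlonglongrightarrow> ?V f"
      by (intro tendsto_add lim tendsto_quad[of v, OF v1, of _ L] L g(1))
    show "\<exists>N. \<forall>j\<ge>N. S - 1 / (real (s j) + 1) \<le> ?V (g (s j))"
      using g(2) less_imp_le by blast
  qed
  moreover have "?V h \<le> S" if "h \<in> polar F" for h
    unfolding S_def by (rule cSUP_upper[OF that bdd])
  ultimately show thesis using that by (meson order_trans)
qed

section \<open>Vectors annihilated by finitely many functionals\<close>

lemma infinite_dimensional_common_kernel:
  fixes f :: "nat \<Rightarrow> 'a::real_normed_vector \<Rightarrow>\<^sub>L real"
  assumes "subspace Y" "infinite_dimensional Y"
  shows "infinite_dimensional {y \<in> Y. \<forall>n<N. blinfun_apply (f n) y = 0}"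
proof (induction N)
  case (Suc N)
  let ?K = "\<lambda>N. {y \<in> Y. \<forall>n<N. blinfun_apply (f n) y = 0}"
  have sub: "subspace (?K M)" for M
    using assms(1) by (auto simp: subspace_def blinfun.add_right blinfun.scaleR_right)
  show ?case
    unfolding infinite_dimensional_def
  proof
    assume "\<exists>B. finite B \<and> span B = ?K (Suc N)"
    then obtain B where B: "finite B" "span B = ?K (Suc N)" by blast
    show False
    proof (cases "\<exists>w\<in>?K N. blinfun_apply (f N) w \<noteq> 0")
      case False
      then have "?K (Suc N) = ?K N" by (auto simp: less_Suc_eq)
      with B Suc.IH show False by (auto simp: infinite_dimensional_def)
    next
      case True
      then obtain w where w: "w \<in> ?K N" "blinfun_apply (f N) w \<noteq> 0" by blast
      \<comment> \<open>One more functional lowers the dimension by at most one: a finite spanning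
        set of the smaller kernel together with \<open>w\<close> spans the larger one, against the
        induction hypothesis.\<close>
      have "span (insert w B) = ?K N"
      proof
        have "B \<subseteq> ?K N" using span_superset[of B] B(2) by (auto simp: less_Suc_eq)
        then show "span (insert w B) \<subseteq> ?K N"
          using w(1) by (intro span_minimal sub) auto
        show "?K N \<subseteq> span (insert w B)"
        proof
          fix y assume y: "y \<in> ?K N"
          define t where "t = blinfun_apply (f N) y / blinfun_apply (f N) w"
          have "y - t *\<^sub>R w \<in> ?K N"
            by (rule subspace_diff[OF sub y subspace_scale[OF sub w(1)]])
          moreover have "blinfun_apply (f N) (y - t *\<^sub>R w) = 0"
            using w(2) by (simp add: t_def blinfun.diff_right blinfun.scaleR_right)
          ultimately have "y - t *\<^sub>R w \<in> span B" unfolding B(2) by (auto simp: less_Suc_eq)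
          then show "y \<in> span (insert w B)" unfolding span_breakdown_eq by blast
        qed
      qed
      with B(1) Suc.IH show False by (auto simp: infinite_dimensional_def)
    qed
  qed
qed (use assms in simp)

text \<open>The common kernel is infinite-dimensional and so differs from \<open>{0}\<close>, the
  span of the empty set. Its vectors are perturbation directions that the first \<open>N\<close>
  functionals do not see.\<close>

lemma common_kernel_vector:
  fixes f :: "nat \<Rightarrow> 'a::real_normed_vector \<Rightarrow>\<^sub>L real"
  assumes "subspace Y" "infinite_dimensional Y" "e > 0"
  obtains v where "v \<in> Y" "v \<noteq> 0" "norm v \<le> e" "\<And>n. n < N \<Longrightarrow> blinfun_apply (f n) v = 0"
proof -
  let ?K = "{y \<in> Y. \<forall>n<N. blinfun_apply (f n) y = 0}"
  have "?K \<noteq> {0}"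
    using infinite_dimensional_common_kernel[OF assms(1,2), of N f]
    by (metis finite.emptyI infinite_dimensional_def span_empty)
  moreover have "0 \<in> ?K" using assms(1) by (auto simp: subspace_def blinfun.zero_right)
  ultimately obtain w where w: "w \<in> ?K" "w \<noteq> 0" by blast
  show thesis
    by (rule that[of "(e / norm w) *\<^sub>R w"])
      (use w assms in \<open>auto simp: blinfun.scaleR_right subspace_scale\<close>)
qed

text \<open>\<open>C\<close> is a sublevel set of the function in the introduction. Near
  \<open>z\<close> the first \<open>N\<close> constraints persist because the perturbation lies in
  their kernels; the later ones persist because they stay below the constraint of a maximizer at
  \<open>z\<close>.\<close>

lemma countable_weak_star_exposed_imp_perturbable:
  fixes F Y :: "'a::{banach, second_countable_topology} set"
  assumes F: "bounded F" "0 \<in> interior F" and Y: "subspace Y" "infinite_dimensional Y"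
    and count: "countable (weak_star_exposed (polar F))"
  obtains C where "C \<subseteq> Y" "bounded C" "0 \<in> C"
    "\<And>z. \<exists>d>0. \<exists>v. v \<noteq> 0 \<and> (\<forall>x\<in>C. dist x z < d \<longrightarrow> x + v \<in> C \<and> x - v \<in> C)"
proof -
  obtain v :: "nat \<Rightarrow> 'a" where v1: "\<And>k. norm (v k) \<le> 1"
    and sep: "\<And>f g :: 'a \<Rightarrow>\<^sub>L real. (\<And>k. blinfun_apply f (v k) = blinfun_apply g (v k)) \<Longrightarrow> f = g"
    using separating_sequence_exists by metis
  obtain r where r: "r > 0" "cball 0 r \<subseteq> F"
    using F(2) by (auto simp: mem_interior_cball)
  define L where "L = 1 / r"
  have L0: "L > 0" using r by (simp add: L_def)
  have L: "norm f \<le> L" if "f \<in> polar F" for f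
    using polar_norm_le[OF r that] by (simp add: L_def)
  let ?E = "weak_star_exposed (polar F)"
  have max: "\<exists>f\<in>?E. \<forall>g\<in>polar F. blinfun_apply g x + quad v g \<le> blinfun_apply f x + quad v f" for x
  proof -
    obtain f where f: "f \<in> polar F"
      and fm: "\<And>g. g \<in> polar F \<Longrightarrow> blinfun_apply g x + quad v g \<le> blinfun_apply f x + quad v f"
      using polar_maximizer_exists[of v F L x, OF v1 L] by blast
    then show ?thesis using maximizer_weak_star_exposed[of v, OF v1 sep f fm] by blast
  qed
  then have "?E \<noteq> {}" by blast
  define f where "f = from_nat_into ?E"
  have f: "range f = ?E" unfolding f_def by (rule range_from_nat_into[OF \<open>?E \<noteq> {}\<close> count])
  then have f_polar: "f n \<in> polar F" for n by (auto simp: weak_star_exposed_def)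
  have fL: "\<bar>blinfun_apply (f n) x\<bar> \<le> L * norm x" for n x
    using norm_blinfun[of "f n" x] mult_right_mono[OF L[OF f_polar[of n]] norm_ge_zero[of x]] by simp
  have fmax: "\<exists>m. \<forall>g\<in>polar F. blinfun_apply g x + quad v g \<le> blinfun_apply (f m) x + quad v (f m)" for x
    using max[of x] unfolding f[symmetric] by blast
  \<comment> \<open>The bonus \<open>1 / (real n + 1)\<close> is positive and tends to
    \<open>0\<close>, so a maximizing index \<open>m\<close> beats all late indices by a
    margin.\<close>
  define c where "c n = quad v (f n) + 1 / (real n + 1)" for n
  \<comment> \<open>\<open>2 * L\<^sup>2\<close> bounds \<open>quad v\<close> on the polar and
    \<open>1\<close> bounds the bonus, hence \<open>0 \<in> C\<close>.\<close>
  define R where "R = 2 * L\<^sup>2 + 1"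
  define C where "C = {x\<in>Y. \<forall>n. blinfun_apply (f n) x + c n \<le> R}"
  show thesis
  proof (rule that[of C])
    show "C \<subseteq> Y" by (auto simp: C_def)
    have "c n \<le> R" for n
      using quad_bounds(3)[of v, OF v1 L[OF f_polar[of n]]] by (simp add: c_def R_def add_mono)
    then show "0 \<in> C" using Y(1) by (auto simp: C_def subspace_0 blinfun.zero_right)
    obtain b where b: "b > 0" "\<And>x. x \<in> F \<Longrightarrow> norm x \<le> b"
      using F(1) by (auto simp: bounded_pos)
    have "norm x \<le> b * R" if "x \<in> C" for x
    proof -
      obtain h :: "'a \<Rightarrow>\<^sub>L real" where h: "norm h \<le> 1" "blinfun_apply h x = norm x"
        using norming_functional by blast
      have "blinfun_apply h y \<le> b" if "y \<in> F" for y
        using norm_blinfun[of h y] mult_mono[OF h(1) b(2)[OF that]] b(1) by simp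
      \<comment> \<open>Dividing by the bound \<open>b\<close> of \<open>F\<close> puts the norming
        functional into the polar, where the maximizer at \<open>x\<close> dominates it; this bounds
        \<open>norm x\<close>.\<close>
      then have hp: "(1 / b) *\<^sub>R h \<in> polar F"
        using b(1) by (auto simp: polar_def blinfun.scaleR_left field_simps)
      obtain m where m: "\<forall>g\<in>polar F. blinfun_apply g x + quad v g \<le> blinfun_apply (f m) x + quad v (f m)"
        using fmax by blast
      have "norm x / b \<le> blinfun_apply (f m) x + quad v (f m)"
        using m[rule_format, OF hp] quad_bounds(2)[of v, OF v1 order_refl, of "(1 / b) *\<^sub>R h"] h(2)
        by (simp add: blinfun.scaleR_left)
      also have "\<dots> \<le> blinfun_apply (f m) x + c m" by (simp add: c_def)
      also have "\<dots> \<le> R" using that by (simp add: C_def)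
      finally show ?thesis using b(1) by (simp add: field_simps)
    qed
    then show "bounded C" unfolding bounded_iff by blast
    fix z
    obtain m where m: "\<forall>g\<in>polar F. blinfun_apply g z + quad v g \<le> blinfun_apply (f m) z + quad v (f m)"
      using fmax by blast
    \<comment> \<open>Half of the bonus of \<open>m\<close>. One half pays for the bonus of a late
      index \<open>n\<close>; the other is \<open>3 * L * d\<close>, two errors for moving from
      \<open>z\<close> to \<open>x + u\<close> under \<open>f n\<close> and one for moving from
      \<open>z\<close> to \<open>x\<close> under \<open>f m\<close>.\<close>
    define e where "e = 1 / (2 * (real m + 1))"
    have e: "e > 0" by (simp add: e_def)
    define d where "d = e / (3 * L)"
    have d: "d > 0" "3 * L * d = e" using e L0 by (auto simp: d_def)
    obtain N where N: "\<And>n. n \<ge> N \<Longrightarrow> 1 / (real n + 1) < e"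
    proof -
      obtain N where N: "1 / (real N + 1) < e"
        using nat_approx_posE[OF e] by (metis add.commute of_nat_Suc)
      have "1 / (real n + 1) < e" if "n \<ge> N" for n
        using N that by (smt (verit) frac_le of_nat_0_le_iff of_nat_mono)
      then show thesis using that by blast
    qed
    obtain y where y: "y \<in> Y" "y \<noteq> 0" "norm y \<le> d" "\<And>n. n < N \<Longrightarrow> blinfun_apply (f n) y = 0"
      using common_kernel_vector[OF Y d(1)] by metis
    have step: "x + u \<in> C" if x: "x \<in> C" "dist x z < d"
      and u: "u \<in> Y" "norm u \<le> d" "\<And>n. n < N \<Longrightarrow> blinfun_apply (f n) u = 0" for x u
    proof -
      have "blinfun_apply (f n) (x + u) + c n \<le> R" for n
      proof (cases "n < N")
        case True
        then show ?thesis using x(1) u(3) by (simp add: C_def blinfun.add_right)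
      next
        case False
        have near: "\<bar>blinfun_apply (f k) (x - z)\<bar> \<le> L * d" for k
          using fL[of k "x - z"] x(2) L0 mult_left_mono[of "norm (x - z)" d L] unfolding dist_norm by linarith
        have "\<bar>blinfun_apply (f n) u\<bar> \<le> L * d"
          using fL[of n u] u(2) L0 mult_left_mono[of "norm u" d L] by linarith
        then have "blinfun_apply (f n) (x + u) + c n
            \<le> blinfun_apply (f n) z + quad v (f n) + 2 * (L * d) + 1 / (real n + 1)"
          using near[of n] by (simp add: c_def blinfun.add_right blinfun.diff_right)
        also have "\<dots> \<le> blinfun_apply (f m) z + quad v (f m) + 2 * (L * d) + e"
          using m f_polar[of n] N[of n] False by fastforce
        also have "\<dots> \<le> blinfun_apply (f m) x + quad v (f m) + 3 * (L * d) + e"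
          using near[of m] by (simp add: blinfun.diff_right)
        also have "\<dots> = blinfun_apply (f m) x + c m"
          using d(2) by (simp add: c_def e_def field_simps)
        also have "\<dots> \<le> R" using x(1) by (simp add: C_def)
        finally show ?thesis .
      qed
      moreover have "x + u \<in> Y" using x(1) u(1) Y(1) by (auto simp: C_def subspace_add)
      ultimately show ?thesis by (simp add: C_def)
    qed
    have "x + y \<in> C \<and> x - y \<in> C" if "x \<in> C" "dist x z < d" for x
      using step[OF that y(1,3,4)] step[OF that, of "- y"] y Y(1)
      by (simp add: subspace_neg blinfun.minus_right)
    with d(1) y(2) show "\<exists>d>0. \<exists>v. v \<noteq> 0 \<and> (\<forall>x\<in>C. dist x z < d \<longrightarrow> x + v \<in> C \<and> x - v \<in> C)"
      by blast
  qed
qed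

subsection \<open>Dyadic approximation on the unit interval\<close>

text \<open>The half-open interval is partitioned by the cells
  \<open>[k / 2^n, (k + 1) / 2^n)\<close>.\<close>

definition unit_lebesgue :: "real measure" where
  "unit_lebesgue = restrict_space lborel {0..<1}"

text \<open>The number of the level \<open>n\<close> cell that contains \<open>\<omega>\<close>.
  Step functions of level \<open>n\<close> are written as \<open>F (dyadic_index n \<omega>)\<close>
  throughout.\<close>

definition dyadic_index :: "nat \<Rightarrow> real \<Rightarrow> nat" where
  "dyadic_index n \<omega> = nat \<lfloor>2 ^ n * \<omega>\<rfloor>"

lemma space_unit_lebesgue [simp]: "space unit_lebesgue = {0..<1}"
  by (simp add: unit_lebesgue_def space_restrict_space)

lemma sets_unit_lebesgue: "sets unit_lebesgue = {A \<in> sets borel. A \<subseteq> {0..<1}}"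
  unfolding unit_lebesgue_def by (subst sets_restrict_space_iff | auto simp: sets_restrict_space)+

lemma measurable_unit_lebesgue:
  "f \<in> measurable borel N \<Longrightarrow> f \<in> measurable unit_lebesgue N"
  unfolding unit_lebesgue_def by (intro measurable_restrict_space1) simp

lemma measure_unit_lebesgue: "A \<subseteq> {0..<1} \<Longrightarrow> measure unit_lebesgue A = measure lborel A"
  unfolding unit_lebesgue_def by (rule measure_restrict_space) auto

lemma finite_measure_unit_lebesgue: "finite_measure unit_lebesgue"
  by (rule finite_measureI) (simp add: unit_lebesgue_def emeasure_restrict_space)

interpretation U: finite_measure unit_lebesgue
  by (rule finite_measure_unit_lebesgue)

lemma measure_space_unit_lebesgue: "measure unit_lebesgue {0..<1} = 1"
  by (simp add: measure_unit_lebesgue)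

lemma dyadic_index_measurable [measurable]:
  "dyadic_index n \<in> measurable unit_lebesgue (count_space UNIV)"
  unfolding dyadic_index_def[abs_def] by (rule measurable_unit_lebesgue) measurable

lemma dyadic_index_less: "\<omega> \<in> {0..<1} \<Longrightarrow> dyadic_index n \<omega> < 2 ^ n"
  unfolding dyadic_index_def by (simp add: nat_less_iff floor_less_iff)

text \<open>Division drops the last \<open>j\<close> binary digits. Thus a step function of level
  \<open>n\<close> can be rewritten at every finer level.\<close>

lemma dyadic_index_add_div: "dyadic_index (n + j) \<omega> div 2 ^ j = dyadic_index n \<omega>"
proof -
  have "\<lfloor>2 ^ (n + j) * \<omega>\<rfloor> div 2 ^ j = \<lfloor>2 ^ (n + j) * \<omega> / real_of_int (2 ^ j)\<rfloor>"
    by (rule floor_divide_real_eq_div[symmetric]) simp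
  also have "2 ^ (n + j) * \<omega> / real_of_int (2 ^ j) = 2 ^ n * \<omega>"
    by (simp add: power_add)
  finally have eq: "\<lfloor>2 ^ (n + j) * \<omega>\<rfloor> div 2 ^ j = \<lfloor>2 ^ n * \<omega>\<rfloor>" .
  show ?thesis
  proof (cases "\<omega> \<ge> 0")
    case True
    then show ?thesis
      unfolding dyadic_index_def eq[symmetric] by (simp add: nat_div_distrib nat_power_eq)
  next
    case False
    \<comment> \<open>For negative \<open>\<omega>\<close> both indices are \<open>0\<close>, since
      \<open>nat\<close> truncates.\<close>
    then have "2 ^ m * \<omega> \<le> 0" for m by (simp add: mult_nonneg_nonpos)
    then have "\<lfloor>2 ^ m * \<omega>\<rfloor> \<le> 0" for m by (metis floor_mono floor_zero)
    then show ?thesis by (simp add: dyadic_index_def)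
  qed
qed

lemma dyadic_index_Suc_div: "dyadic_index (Suc n) \<omega> div 2 = dyadic_index n \<omega>"
  using dyadic_index_add_div[of n 1 \<omega>] by simp

lemma measure_dyadic_index:
  assumes "k < 2 ^ n"
  shows "measure unit_lebesgue {\<omega> \<in> {0..<1}. dyadic_index n \<omega> = k} = 1 / 2 ^ n"
proof -
  define a b where "a = real k / 2 ^ n" and "b = (real k + 1) / 2 ^ n"
  have "real k + 1 \<le> 2 ^ n"
    using assms by (metis Suc_leI add.commute of_nat_Suc of_nat_le_numeral_power_cancel_iff)
  then have ab: "0 \<le> a" "a \<le> b" "b \<le> 1" "b - a = 1 / 2 ^ n"
    by (auto simp: a_def b_def divide_right_mono field_simps)
  have iff: "dyadic_index n \<omega> = k \<longleftrightarrow> a \<le> \<omega> \<and> \<omega> < b" if "\<omega> \<ge> 0" for \<omega>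
  proof -
    have "dyadic_index n \<omega> = k \<longleftrightarrow> \<lfloor>2 ^ n * \<omega>\<rfloor> = int k"
      using that by (auto simp: dyadic_index_def)
    then show ?thesis by (simp add: floor_eq_iff a_def b_def field_simps)
  qed
  have "{\<omega> \<in> {0..<1}. dyadic_index n \<omega> = k} = {a..<b}"
  proof (rule set_eqI)
    show "\<omega> \<in> {\<omega> \<in> {0..<1}. dyadic_index n \<omega> = k} \<longleftrightarrow> \<omega> \<in> {a..<b}" for \<omega>
      using ab by (cases "\<omega> \<ge> 0") (auto simp: iff)
  qed
  with ab show ?thesis by (simp add: measure_unit_lebesgue)
qed

text \<open>Only the finitely many values \<open>F k\<close> with \<open>k < 2 ^ n\<close> occur on
  the unit interval.\<close>

lemma integrable_dyadic:
  fixes F :: "nat \<Rightarrow> 'b::{banach, second_countable_topology}"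
  shows "integrable unit_lebesgue (\<lambda>\<omega>. F (dyadic_index n \<omega>))"
proof (rule U.integrable_const_bound)
  show "AE \<omega> in unit_lebesgue. norm (F (dyadic_index n \<omega>)) \<le> Max ((\<lambda>k. norm (F k)) ` {..<2 ^ n})"
    using dyadic_index_less by (intro AE_I2 Max_ge) auto
  show "(\<lambda>\<omega>. F (dyadic_index n \<omega>)) \<in> borel_measurable unit_lebesgue"
    by measurable
qed

lemma integral_indicator_scaleR:
  fixes c :: "'b::{banach, second_countable_topology}"
  assumes D: "D \<in> sets unit_lebesgue"
  shows "(\<integral>\<omega>. indicator D \<omega> *\<^sub>R c \<partial>unit_lebesgue) = measure unit_lebesgue D *\<^sub>R c"
proof -
  have "integrable unit_lebesgue (indicator D :: real \<Rightarrow> real)"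
    by (rule integrable_real_indicator[OF D]) (simp add: U.emeasure_finite less_top[symmetric])
  then have "(\<integral>\<omega>. indicator D \<omega> *\<^sub>R c \<partial>unit_lebesgue) = (\<integral>\<omega>. indicator D \<omega> \<partial>unit_lebesgue) *\<^sub>R c"
    by (intro integral_scaleR_left)
  then show ?thesis
    using sets.sets_into_space[OF D] by (simp add: Int_absorb2)
qed

lemma set_integral_dyadic:
  fixes F :: "nat \<Rightarrow> 'b::{banach, second_countable_topology}"
  assumes E: "E \<in> sets unit_lebesgue"
  shows "(LINT \<omega>:E|unit_lebesgue. F (dyadic_index n \<omega>))
    = (\<Sum>k<2 ^ n. measure unit_lebesgue {\<omega> \<in> E. dyadic_index n \<omega> = k} *\<^sub>R F k)"
proof -
  let ?D = "\<lambda>k. {\<omega> \<in> E. dyadic_index n \<omega> = k}"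
  have E1: "E \<subseteq> {0..<1}" using sets.sets_into_space[OF E] by simp
  have D: "?D k \<in> sets unit_lebesgue" for k
  proof -
    have "E \<inter> {\<omega> \<in> space unit_lebesgue. dyadic_index n \<omega> = k} \<in> sets unit_lebesgue"
      by (rule sets.Int[OF E]) measurable
    also have "E \<inter> {\<omega> \<in> space unit_lebesgue. dyadic_index n \<omega> = k} = ?D k"
      using E1 by auto
    finally show ?thesis .
  qed
  have "(LINT \<omega>:E|unit_lebesgue. F (dyadic_index n \<omega>))
      = (\<integral>\<omega>. (\<Sum>k<2 ^ n. indicator (?D k) \<omega> *\<^sub>R F k) \<partial>unit_lebesgue)"
    unfolding set_lebesgue_integral_def
  proof (rule Bochner_Integration.integral_cong[OF refl])
    fix \<omega> assume "\<omega> \<in> space unit_lebesgue"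
    then have "dyadic_index n \<omega> < 2 ^ n" using dyadic_index_less by simp
    moreover have "(\<Sum>k<2 ^ n. indicator (?D k) \<omega> *\<^sub>R F k)
        = (\<Sum>k<2 ^ n. if k = dyadic_index n \<omega> then indicator E \<omega> *\<^sub>R F k else 0)"
      by (intro sum.cong) (auto simp: indicator_def)
    ultimately show "indicator E \<omega> *\<^sub>R F (dyadic_index n \<omega>) = (\<Sum>k<2 ^ n. indicator (?D k) \<omega> *\<^sub>R F k)"
      by (simp add: sum.delta)
  qed
  also have "\<dots> = (\<Sum>k<2 ^ n. (\<integral>\<omega>. indicator (?D k) \<omega> *\<^sub>R F k \<partial>unit_lebesgue))"
    by (intro Bochner_Integration.integral_sum integrable_scaleR_left) (auto intro!: integrable_real_indicator D simp: U.emeasure_finite less_top[symmetric])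
  also have "\<dots> = (\<Sum>k<2 ^ n. measure unit_lebesgue (?D k) *\<^sub>R F k)"
    by (intro sum.cong refl integral_indicator_scaleR D)
  finally show ?thesis .
qed

lemma integral_dyadic:
  fixes F :: "nat \<Rightarrow> 'b::{banach, second_countable_topology}"
  shows "(\<integral>\<omega>. F (dyadic_index n \<omega>) \<partial>unit_lebesgue) = (\<Sum>k<2 ^ n. (1 / 2 ^ n) *\<^sub>R F k)"
proof -
  have "(\<integral>\<omega>. F (dyadic_index n \<omega>) \<partial>unit_lebesgue) = (LINT \<omega>:space unit_lebesgue|unit_lebesgue. F (dyadic_index n \<omega>))"
    by (simp only: set_integral_space[OF integrable_dyadic])
  also have "\<dots> = (\<Sum>k<2 ^ n. (1 / 2 ^ n) *\<^sub>R F k)"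
    by (subst set_integral_dyadic[OF sets.top], intro sum.cong refl) (simp only: space_unit_lebesgue lessThan_iff measure_dyadic_index)
  finally show ?thesis .
qed

lemma sum_lessThan_pairs:
  fixes F :: "nat \<Rightarrow> 'b::comm_monoid_add"
  shows "(\<Sum>k<2 * N. F k) = (\<Sum>k<N. F (2 * k) + F (2 * k + 1))"
  by (induction N) (auto simp: add.assoc)

text \<open>Cells \<open>2 * k\<close> and \<open>2 * k + 1\<close> are the halves of one cell of
  level \<open>n\<close> and have equal measure, so opposite values cancel. Martingale increments
  are of this kind.\<close>

lemma integral_dyadic_zero:
  fixes F :: "nat \<Rightarrow> 'b::{banach, second_countable_topology}"
  assumes "\<And>k. F (2 * k) + F (2 * k + 1) = 0"
  shows "(\<integral>\<omega>. F (dyadic_index (Suc n) \<omega>) \<partial>unit_lebesgue) = 0"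
  unfolding integral_dyadic power_Suc sum_lessThan_pairs
  using assms by (simp flip: scaleR_right_distrib)

text \<open>Membership in the L1 closure of the dyadic step functions. The notion is meant for
  integrable \<open>f\<close>, since the integral of a non-integrable function is \<open>0\<close>
  by default.\<close>

definition dyadic_approximable :: "(real \<Rightarrow> 'b::{banach, second_countable_topology}) \<Rightarrow> bool" where
  "dyadic_approximable f \<longleftrightarrow>
    (\<forall>e>0. \<exists>n F. (\<integral>\<omega>. norm (f \<omega> - F (dyadic_index n \<omega>)) \<partial>unit_lebesgue) < e)"

lemma dyadic_approximable_add:
  assumes f: "integrable unit_lebesgue f" "dyadic_approximable f"
    and g: "integrable unit_lebesgue g" "dyadic_approximable g"
  shows "dyadic_approximable (\<lambda>\<omega>. f \<omega> + g \<omega>)"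
  unfolding dyadic_approximable_def
proof (intro allI impI)
  fix e :: real assume "e > 0"
  then have "e / 2 > 0" by simp
  obtain n F where F: "(\<integral>\<omega>. norm (f \<omega> - F (dyadic_index n \<omega>)) \<partial>unit_lebesgue) < e / 2"
    using f(2) \<open>e / 2 > 0\<close> unfolding dyadic_approximable_def by blast
  obtain m G where G: "(\<integral>\<omega>. norm (g \<omega> - G (dyadic_index m \<omega>)) \<partial>unit_lebesgue) < e / 2"
    using g(2) \<open>e / 2 > 0\<close> unfolding dyadic_approximable_def by blast
  \<comment> \<open>Both step functions are read off at the common level
    \<open>n + m\<close>.\<close>
  define H where "H k = F (k div 2 ^ m) + G (k div 2 ^ n)" for k
  have H: "H (dyadic_index (n + m) \<omega>) = F (dyadic_index n \<omega>) + G (dyadic_index m \<omega>)" for \<omega>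
    using dyadic_index_add_div[of n m \<omega>] dyadic_index_add_div[of m n \<omega>] by (simp add: H_def add.commute)
  have "(\<integral>\<omega>. norm (f \<omega> + g \<omega> - H (dyadic_index (n + m) \<omega>)) \<partial>unit_lebesgue)
      \<le> (\<integral>\<omega>. norm (f \<omega> - F (dyadic_index n \<omega>)) + norm (g \<omega> - G (dyadic_index m \<omega>)) \<partial>unit_lebesgue)"
  proof (rule integral_mono)
    show "norm (f \<omega> + g \<omega> - H (dyadic_index (n + m) \<omega>))
        \<le> norm (f \<omega> - F (dyadic_index n \<omega>)) + norm (g \<omega> - G (dyadic_index m \<omega>))" for \<omega>
      unfolding H by (rule norm_diff_triangle_ineq)
  qed (intro Bochner_Integration.integrable_add integrable_norm Bochner_Integration.integrable_diff f g integrable_dyadic)+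
  also have "\<dots> = (\<integral>\<omega>. norm (f \<omega> - F (dyadic_index n \<omega>)) \<partial>unit_lebesgue)
      + (\<integral>\<omega>. norm (g \<omega> - G (dyadic_index m \<omega>)) \<partial>unit_lebesgue)"
    by (intro Bochner_Integration.integral_add integrable_norm Bochner_Integration.integrable_diff f g integrable_dyadic)
  also have "\<dots> < e" using F G by simp
  finally show "\<exists>n H. (\<integral>\<omega>. norm (f \<omega> + g \<omega> - H (dyadic_index n \<omega>)) \<partial>unit_lebesgue) < e"
    by blast
qed

lemma dyadic_approximable_scaleR:
  fixes f :: "real \<Rightarrow> real" and c :: "'b::{banach, second_countable_topology}"
  assumes "dyadic_approximable f"
  shows "dyadic_approximable (\<lambda>\<omega>. f \<omega> *\<^sub>R c)"
  unfolding dyadic_approximable_def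
proof (intro allI impI)
  fix e :: real assume e: "e > 0"
  have c: "0 < norm c + 1" using norm_ge_zero[of c] by linarith
  obtain n F where F: "(\<integral>\<omega>. norm (f \<omega> - F (dyadic_index n \<omega>)) \<partial>unit_lebesgue) < e / (norm c + 1)"
    using assms divide_pos_pos[OF e c] unfolding dyadic_approximable_def by blast
  have "(\<integral>\<omega>. norm (f \<omega> *\<^sub>R c - F (dyadic_index n \<omega>) *\<^sub>R c) \<partial>unit_lebesgue)
      = (\<integral>\<omega>. norm (f \<omega> - F (dyadic_index n \<omega>)) \<partial>unit_lebesgue) * norm c"
    by (simp flip: scaleR_diff_left)
  also have "\<dots> \<le> (\<integral>\<omega>. norm (f \<omega> - F (dyadic_index n \<omega>)) \<partial>unit_lebesgue) * (norm c + 1)"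
    by (intro mult_left_mono integral_nonneg) auto
  also have "\<dots> < e" using F c by (simp add: pos_less_divide_eq)
  finally show "\<exists>n F. (\<integral>\<omega>. norm (f \<omega> *\<^sub>R c - F (dyadic_index n \<omega>)) \<partial>unit_lebesgue) < e"
    by (intro exI[of _ n] exI[of _ "\<lambda>k. F k *\<^sub>R c"])
qed

text \<open>Dominated convergence makes some \<open>s i\<close> close to \<open>f\<close> in L1, and
  a step function close to \<open>s i\<close> then serves for \<open>f\<close>.\<close>

lemma dyadic_approximable_limit:
  assumes s: "\<And>i. integrable unit_lebesgue (s i)" "\<And>i. dyadic_approximable (s i)"
    and f: "integrable unit_lebesgue f"
    and lim: "\<And>\<omega>. \<omega> \<in> {0..<1} \<Longrightarrow> (\<lambda>i. s i \<omega>) \<longlonglongrightarrow> f \<omega>"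
    and bound: "\<And>i \<omega>. \<omega> \<in> {0..<1} \<Longrightarrow> norm (s i \<omega>) \<le> w \<omega>" and w: "integrable unit_lebesgue w"
  shows "dyadic_approximable f"
  unfolding dyadic_approximable_def
proof (intro allI impI)
  fix e :: real assume e: "e > 0"
  have "(\<lambda>i. \<integral>\<omega>. norm (f \<omega> - s i \<omega>) \<partial>unit_lebesgue) \<longlonglongrightarrow> (\<integral>\<omega>. 0 \<partial>unit_lebesgue)"
  proof (rule integral_dominated_convergence)
    show "integrable unit_lebesgue (\<lambda>\<omega>. norm (f \<omega>) + w \<omega>)" using f w by simp
    show "AE \<omega> in unit_lebesgue. (\<lambda>i. norm (f \<omega> - s i \<omega>)) \<longlonglongrightarrow> 0"
    proof (rule AE_I2)
      fix \<omega> assume "\<omega> \<in> space unit_lebesgue"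
      then have "(\<lambda>i. norm (f \<omega> - s i \<omega>)) \<longlonglongrightarrow> norm (f \<omega> - f \<omega>)"
        by (intro tendsto_intros lim) simp
      then show "(\<lambda>i. norm (f \<omega> - s i \<omega>)) \<longlonglongrightarrow> 0" by simp
    qed
    show "AE \<omega> in unit_lebesgue. norm (norm (f \<omega> - s i \<omega>)) \<le> norm (f \<omega>) + w \<omega>" for i
    proof (rule AE_I2)
      fix \<omega> assume "\<omega> \<in> space unit_lebesgue"
      with bound[of \<omega> i] norm_triangle_ineq4[of "f \<omega>" "s i \<omega>"]
      show "norm (norm (f \<omega> - s i \<omega>)) \<le> norm (f \<omega>) + w \<omega>" by simp
    qed
    show "(\<lambda>\<omega>. norm (f \<omega> - s i \<omega>)) \<in> borel_measurable unit_lebesgue" for i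
      using f s(1)[of i] by measurable
  qed simp
  then have "\<forall>\<^sub>F i in sequentially. (\<integral>\<omega>. norm (f \<omega> - s i \<omega>) \<partial>unit_lebesgue) < e / 2"
    using e by (intro order_tendstoD(2)) auto
  then obtain i where i: "(\<integral>\<omega>. norm (f \<omega> - s i \<omega>) \<partial>unit_lebesgue) < e / 2"
    by (auto simp: eventually_sequentially)
  obtain n F where F: "(\<integral>\<omega>. norm (s i \<omega> - F (dyadic_index n \<omega>)) \<partial>unit_lebesgue) < e / 2"
    using s(2)[of i] e unfolding dyadic_approximable_def by (meson half_gt_zero)
  have "(\<integral>\<omega>. norm (f \<omega> - F (dyadic_index n \<omega>)) \<partial>unit_lebesgue)
      \<le> (\<integral>\<omega>. norm (f \<omega> - s i \<omega>) + norm (s i \<omega> - F (dyadic_index n \<omega>)) \<partial>unit_lebesgue)"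
  proof (rule integral_mono)
    show "norm (f \<omega> - F (dyadic_index n \<omega>)) \<le> norm (f \<omega> - s i \<omega>) + norm (s i \<omega> - F (dyadic_index n \<omega>))" for \<omega>
      by (rule norm_diff_triangle_le[OF order_refl order_refl])
  qed (intro Bochner_Integration.integrable_add integrable_norm Bochner_Integration.integrable_diff f s integrable_dyadic)+
  also have "\<dots> = (\<integral>\<omega>. norm (f \<omega> - s i \<omega>) \<partial>unit_lebesgue)
      + (\<integral>\<omega>. norm (s i \<omega> - F (dyadic_index n \<omega>)) \<partial>unit_lebesgue)"
    by (intro Bochner_Integration.integral_add integrable_norm Bochner_Integration.integrable_diff f s integrable_dyadic)
  also have "\<dots> < e" using i F by simp
  finally show "\<exists>n F. (\<integral>\<omega>. norm (f \<omega> - F (dyadic_index n \<omega>)) \<partial>unit_lebesgue) < e"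
    by blast
qed

lemma integrable_indicator_unit_lebesgue:
  "A \<in> sets borel \<Longrightarrow> integrable unit_lebesgue (indicator A :: real \<Rightarrow> real)"
  by (rule U.integrable_const_bound[of _ 1])
    (auto simp: indicator_def intro!: measurable_unit_lebesgue)

text \<open>At level \<open>n\<close> the half-line differs from a union of cells at most on the
  cell containing \<open>a\<close>. The error is \<open>0\<close> if that index lies beyond the unit
  interval, hence the inequality \<open>\<le> (1 / 2) ^ n\<close>.\<close>

lemma dyadic_approximable_lessThan: "dyadic_approximable (indicator {..<a} :: real \<Rightarrow> real)"
  unfolding dyadic_approximable_def
proof (intro allI impI)
  fix e :: real assume e: "e > 0"
  obtain n where n: "(1 / 2) ^ n < e"
    using real_arch_pow_inv[OF e, of "1 / 2"] by auto
  define F :: "nat \<Rightarrow> real" where "F k = (if k < dyadic_index n a then 1 else 0)" for k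
  define H :: "nat \<Rightarrow> real" where "H k = (if k = dyadic_index n a then 1 else 0)" for k
  have "(\<integral>\<omega>. norm (indicator {..<a} \<omega> - F (dyadic_index n \<omega>)) \<partial>unit_lebesgue)
      \<le> (\<integral>\<omega>. H (dyadic_index n \<omega>) \<partial>unit_lebesgue)"
  proof (rule integral_mono)
    fix \<omega>
    have "\<omega> \<le> b \<Longrightarrow> dyadic_index n \<omega> \<le> dyadic_index n b" for \<omega> b
      unfolding dyadic_index_def by (intro nat_mono floor_mono) simp
    from this[of \<omega> a] this[of a \<omega>]
    show "norm (indicator {..<a} \<omega> - F (dyadic_index n \<omega>)) \<le> H (dyadic_index n \<omega>)"
      by (cases "\<omega> < a") (auto simp: F_def H_def)
  qed (intro integrable_norm Bochner_Integration.integrable_diff integrable_dyadic integrable_indicator_unit_lebesgue; simp)+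
  also have "\<dots> \<le> (1 / 2) ^ n"
    by (subst integral_dyadic, unfold H_def) (simp add: if_distrib sum.delta power_one_over cong: if_cong)
  also note n
  finally show "\<exists>n F. (\<integral>\<omega>. norm (indicator {..<a} \<omega> - F (dyadic_index n \<omega>) :: real) \<partial>unit_lebesgue) < e"
    by blast
qed

text \<open>Dynkin's theorem for the intersection-stable generator of half-lines. Complements come
  from \<open>1 - indicator A\<close>, countable disjoint unions as limits of finite ones.\<close>

lemma dyadic_approximable_indicator:
  assumes "A \<in> sets borel"
  shows "dyadic_approximable (indicator A :: real \<Rightarrow> real)"
proof -
  have borel: "sets borel = sigma_sets UNIV (range lessThan :: real set set)"
    by (subst borel_Iio) simp
  have const: "dyadic_approximable (\<lambda>\<omega>. c :: real)" for c
    unfolding dyadic_approximable_def by (intro allI impI exI[of _ 0] exI[of _ "\<lambda>_. c"]) simp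
  from assms have "A \<in> sigma_sets UNIV (range lessThan)" by (simp add: borel)
  then show ?thesis
  proof (rule sigma_sets_induct_disjoint[rotated 2])
    show "Int_stable (range lessThan :: real set set)"
      by (auto simp: Int_stable_def greaterThan_Int_greaterThan)
    show "dyadic_approximable (indicator A :: real \<Rightarrow> real)" if "A \<in> range lessThan" for A
      using that dyadic_approximable_lessThan by auto
    show "dyadic_approximable (indicator {} :: real \<Rightarrow> real)"
      using const[of 0] by (simp add: indicator_def[abs_def])
    show "dyadic_approximable (indicator (UNIV - A) :: real \<Rightarrow> real)"
      if "A \<in> sigma_sets UNIV (range lessThan)" "dyadic_approximable (indicator A :: real \<Rightarrow> real)" for A
    proof -
      have "A \<in> sets borel" using that(1) by (simp add: borel)
      have neg: "dyadic_approximable (\<lambda>\<omega>. indicator A \<omega> *\<^sub>R (- 1 :: real))"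
        by (rule dyadic_approximable_scaleR[OF that(2)])
      have "dyadic_approximable (\<lambda>\<omega>. 1 + indicator A \<omega> *\<^sub>R (- 1 :: real))"
        by (rule dyadic_approximable_add[OF _ const _ neg])
          (use integrable_indicator_unit_lebesgue[OF \<open>A \<in> sets borel\<close>] in auto)
      also have "(\<lambda>\<omega>. 1 + indicator A \<omega> *\<^sub>R (- 1 :: real)) = indicator (UNIV - A)"
        by (auto simp: indicator_def)
      finally show ?thesis .
    qed
    show "dyadic_approximable (indicator (\<Union>i. A i) :: real \<Rightarrow> real)"
      if A: "disjoint_family A" "range A \<subseteq> sigma_sets UNIV (range lessThan)"
        and app: "\<And>i::nat. dyadic_approximable (indicator (A i) :: real \<Rightarrow> real)" for A
    proof -
      have "A i \<in> sets borel" for i using A(2) by (auto simp: borel)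
      then have UN: "(\<Union>i<N. A i) \<in> sets borel" for N by auto
      have "dyadic_approximable (indicator (\<Union>i<N. A i) :: real \<Rightarrow> real)" for N :: nat
      proof (induction N)
        case (Suc N)
        have "dyadic_approximable (\<lambda>\<omega>. indicator (A N) \<omega> + indicator (\<Union>i<N. A i) \<omega> :: real)"
          using \<open>A N \<in> sets borel\<close> UN
          by (intro dyadic_approximable_add app Suc integrable_indicator_unit_lebesgue)
        also have "(\<lambda>\<omega>. indicator (A N) \<omega> + indicator (\<Union>i<N. A i) \<omega> :: real) = indicator (\<Union>i<Suc N. A i)"
        proof -
          have "A N \<inter> (\<Union>i<N. A i) = {}"
            using A(1) unfolding disjoint_family_on_def by (metis (no_types, lifting) Int_UN_distrib SUP_bot_conv(2) UNIV_I lessThan_iff less_irrefl_nat)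
          then show ?thesis by (auto simp: lessThan_Suc indicator_def fun_eq_iff)
        qed
        finally show ?case .
      qed (use const[of 0] in \<open>simp add: indicator_def[abs_def]\<close>)
      then show ?thesis
      proof (rule dyadic_approximable_limit[where w = "\<lambda>_. 1", rotated])
        show "(\<lambda>N. indicator (\<Union>i<N. A i) \<omega> :: real) \<longlonglongrightarrow> indicator (\<Union>i. A i) \<omega>" for \<omega>
          by (rule LIMSEQ_indicator_UN)
      qed (use UN \<open>\<And>i. A i \<in> sets borel\<close> in \<open>auto intro!: integrable_indicator_unit_lebesgue simp: indicator_def\<close>)
    qed
  qed simp
qed

text \<open>Density of dyadic step functions in L1, extended from indicators by induction over
  integrable functions.\<close>

lemma integrable_imp_dyadic_approximable:
  "integrable unit_lebesgue f \<Longrightarrow> dyadic_approximable f"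
proof (induction rule: integrable_induct)
  case (base A c)
  then show ?case
    by (intro dyadic_approximable_scaleR dyadic_approximable_indicator) (simp add: sets_unit_lebesgue)
next
  case (add f g)
  then show ?case by (intro dyadic_approximable_add)
next
  case (lim f s)
  show ?case
    by (rule dyadic_approximable_limit[where s = s and w = "\<lambda>\<omega>. 2 * norm (f \<omega>)"])
      (use lim in simp_all)
qed

subsection \<open>Bounded dyadic martingales and the Radon--Nikodym property\<close>

context
  fixes x :: "nat \<Rightarrow> nat \<Rightarrow> 'a::{banach, second_countable_topology}" and K :: real
  assumes martingale: "\<And>n k. x (Suc n) (2 * k) + x (Suc n) (2 * k + 1) = 2 *\<^sub>R x n k"
    and bounded: "\<And>n k. norm (x n k) \<le> K"
begin

text \<open>The bound is uniform in \<open>n\<close>, so a test function \<open>u\<close> may be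
  replaced by an L1 approximation at a cost independent of the level.\<close>

lemma integrable_scaleR_dyadic:
  assumes u: "integrable unit_lebesgue (u :: real \<Rightarrow> real)"
  shows "integrable unit_lebesgue (\<lambda>\<omega>. u \<omega> *\<^sub>R x n (dyadic_index n \<omega>))"
    and "norm (\<integral>\<omega>. u \<omega> *\<^sub>R x n (dyadic_index n \<omega>) \<partial>unit_lebesgue) \<le> K * (\<integral>\<omega>. \<bar>u \<omega>\<bar> \<partial>unit_lebesgue)"
proof -
  have K0: "K \<ge> 0" using bounded[of 0 0] norm_ge_zero order_trans by blast
  have le: "norm (u \<omega> *\<^sub>R x n (dyadic_index n \<omega>)) \<le> K * \<bar>u \<omega>\<bar>" for \<omega>
    using mult_left_mono[OF bounded abs_ge_zero[of "u \<omega>"]] by (simp add: mult.commute)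
  have Ku: "integrable unit_lebesgue (\<lambda>\<omega>. K * \<bar>u \<omega>\<bar>)" using u by simp
  show int: "integrable unit_lebesgue (\<lambda>\<omega>. u \<omega> *\<^sub>R x n (dyadic_index n \<omega>))"
  proof (rule Bochner_Integration.integrable_bound[OF Ku])
    show "(\<lambda>\<omega>. u \<omega> *\<^sub>R x n (dyadic_index n \<omega>)) \<in> borel_measurable unit_lebesgue"
      using u borel_measurable_integrable[OF integrable_dyadic[of "x n" n]]
      by (intro borel_measurable_scaleR) auto
    show "AE \<omega> in unit_lebesgue. norm (u \<omega> *\<^sub>R x n (dyadic_index n \<omega>)) \<le> norm (K * \<bar>u \<omega>\<bar>)"
      using le K0 by (intro AE_I2) (simp add: abs_mult)
  qed
  have "norm (\<integral>\<omega>. u \<omega> *\<^sub>R x n (dyadic_index n \<omega>) \<partial>unit_lebesgue)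
      \<le> (\<integral>\<omega>. norm (u \<omega> *\<^sub>R x n (dyadic_index n \<omega>)) \<partial>unit_lebesgue)"
    by (rule integral_norm_bound)
  also have "\<dots> \<le> (\<integral>\<omega>. K * \<bar>u \<omega>\<bar> \<partial>unit_lebesgue)"
    by (rule integral_mono[OF integrable_norm[OF int] Ku le])
  finally show "norm (\<integral>\<omega>. u \<omega> *\<^sub>R x n (dyadic_index n \<omega>) \<partial>unit_lebesgue)
      \<le> K * (\<integral>\<omega>. \<bar>u \<omega>\<bar> \<partial>unit_lebesgue)" by simp
qed

text \<open>Against a step function of level \<open>m\<close> the martingale has constant integral
  from level \<open>m\<close> on: on the two halves of a cell its increments are opposite while the
  test function is constant.\<close>

lemma integral_dyadic_martingale:
  "(\<integral>\<omega>. F (dyadic_index m \<omega>) *\<^sub>R x (m + j) (dyadic_index (m + j) \<omega>) \<partial>unit_lebesgue)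
    = (\<integral>\<omega>. F (dyadic_index m \<omega>) *\<^sub>R x m (dyadic_index m \<omega>) \<partial>unit_lebesgue)"
proof (induction j)
  case (Suc j)
  let ?n = "m + j"
  \<comment> \<open>The increment times the test function, written as a step function of level
    \<open>Suc ?n\<close>.\<close>
  define G where "G k = F (k div 2 ^ Suc j) *\<^sub>R (x (Suc ?n) k - x ?n (k div 2))" for k
  have int: "integrable unit_lebesgue (\<lambda>\<omega>. F (dyadic_index m \<omega>) *\<^sub>R x i (dyadic_index i \<omega>))" for i
    by (rule integrable_scaleR_dyadic(1)[OF integrable_dyadic])
  have "(\<integral>\<omega>. F (dyadic_index m \<omega>) *\<^sub>R x (Suc ?n) (dyadic_index (Suc ?n) \<omega>) \<partial>unit_lebesgue)
      - (\<integral>\<omega>. F (dyadic_index m \<omega>) *\<^sub>R x ?n (dyadic_index ?n \<omega>) \<partial>unit_lebesgue)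
      = (\<integral>\<omega>. G (dyadic_index (Suc ?n) \<omega>) \<partial>unit_lebesgue)"
    using dyadic_index_add_div[of m "Suc j"] dyadic_index_Suc_div[of ?n]
    by (subst Bochner_Integration.integral_diff[OF int int, symmetric]) (simp add: G_def scaleR_diff_right)
  also have "\<dots> = 0"
  proof (rule integral_dyadic_zero)
    fix k :: nat
    have "(2 * k) div 2 ^ Suc j = k div 2 ^ j" "(2 * k + 1) div 2 ^ Suc j = k div 2 ^ j"
      by (simp_all add: div_mult2_eq)
    then have "G (2 * k) + G (2 * k + 1)
        = F (k div 2 ^ j) *\<^sub>R (x (Suc ?n) (2 * k) + x (Suc ?n) (2 * k + 1) - 2 *\<^sub>R x ?n k)"
      unfolding G_def by (simp add: algebra_simps scaleR_2)
    then show "G (2 * k) + G (2 * k + 1) = 0" by (simp only: martingale) simp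
  qed
  finally show ?case using Suc by simp
qed simp

text \<open>The indicator of \<open>E\<close> is replaced by a step function of some level
  \<open>m\<close>. From there on its integrals equal the constant \<open>J\<close>, and the
  replacement costs at most \<open>K\<close> times the L1 error.\<close>

lemma Cauchy_set_integral_martingale:
  assumes E: "E \<in> sets unit_lebesgue"
  shows "Cauchy (\<lambda>n. LINT \<omega>:E|unit_lebesgue. x n (dyadic_index n \<omega>))"
proof (rule metric_CauchyI)
  fix e :: real assume e: "e > 0"
  have K0: "K \<ge> 0" using bounded[of 0 0] norm_ge_zero order_trans by blast
  have intE: "integrable unit_lebesgue (indicator E :: real \<Rightarrow> real)"
    using E by (intro integrable_indicator_unit_lebesgue) (simp add: sets_unit_lebesgue)
  have "e / (2 * (K + 1)) > 0" using e K0 by simp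
  then obtain m F where F: "(\<integral>\<omega>. norm (indicator E \<omega> - F (dyadic_index m \<omega>) :: real) \<partial>unit_lebesgue) < e / (2 * (K + 1))"
    using integrable_imp_dyadic_approximable[OF intE] unfolding dyadic_approximable_def by blast
  define J where "J = (\<integral>\<omega>. F (dyadic_index m \<omega>) *\<^sub>R x m (dyadic_index m \<omega>) \<partial>unit_lebesgue)"
  have near: "norm ((LINT \<omega>:E|unit_lebesgue. x n (dyadic_index n \<omega>)) - J) < e / 2" if "n \<ge> m" for n
  proof -
    obtain j where n: "n = m + j" using \<open>n \<ge> m\<close> le_Suc_ex by blast
    have "(LINT \<omega>:E|unit_lebesgue. x n (dyadic_index n \<omega>)) - J
        = (\<integral>\<omega>. (indicator E \<omega> - F (dyadic_index m \<omega>)) *\<^sub>R x n (dyadic_index n \<omega>) \<partial>unit_lebesgue)"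
      unfolding J_def n set_lebesgue_integral_def integral_dyadic_martingale[symmetric, of F m j] scaleR_diff_left
      by (rule Bochner_Integration.integral_diff[symmetric] integrable_scaleR_dyadic intE integrable_dyadic)+
    also have "norm \<dots> \<le> K * (\<integral>\<omega>. \<bar>indicator E \<omega> - F (dyadic_index m \<omega>)\<bar> \<partial>unit_lebesgue)"
      by (intro integrable_scaleR_dyadic Bochner_Integration.integrable_diff intE integrable_dyadic)
    also have "\<dots> \<le> K * (e / (2 * (K + 1)))"
      using F K0 by (intro mult_left_mono) auto
    also have "\<dots> < e / 2" using e K0 by (simp add: field_simps)
    finally show ?thesis .
  qed
  show "\<exists>N. \<forall>i\<ge>N. \<forall>n\<ge>N. dist (LINT \<omega>:E|unit_lebesgue. x i (dyadic_index i \<omega>))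
      (LINT \<omega>:E|unit_lebesgue. x n (dyadic_index n \<omega>)) < e"
  proof (intro exI[of _ m] allI impI)
    fix i n assume "i \<ge> m" "n \<ge> m"
    then show "dist (LINT \<omega>:E|unit_lebesgue. x i (dyadic_index i \<omega>))
        (LINT \<omega>:E|unit_lebesgue. x n (dyadic_index n \<omega>)) < e"
      using dist_triangle_half_l[of _ J e] near unfolding dist_norm by blast
  qed
qed

section \<open>The vector measure of a bounded dyadic martingale\<close>

definition martingale_measure :: "real set \<Rightarrow> 'a" where
  "martingale_measure E = lim (\<lambda>n. LINT \<omega>:E|unit_lebesgue. x n (dyadic_index n \<omega>))"

lemma tendsto_martingale_measure:
  assumes "E \<in> sets unit_lebesgue"
  shows "(\<lambda>n. LINT \<omega>:E|unit_lebesgue. x n (dyadic_index n \<omega>)) \<longlonglongrightarrow> martingale_measure E"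
proof -
  have "convergent (\<lambda>n. LINT \<omega>:E|unit_lebesgue. x n (dyadic_index n \<omega>))"
    by (rule Cauchy_convergent[OF Cauchy_set_integral_martingale[OF assms]])
  then show ?thesis
    by (simp only: convergent_LIMSEQ_iff martingale_measure_def)
qed

text \<open>This estimate yields countable additivity, absolute continuity and bounded
  variation.\<close>

lemma norm_martingale_measure_le:
  assumes E: "E \<in> sets unit_lebesgue"
  shows "norm (martingale_measure E) \<le> K * measure unit_lebesgue E"
proof (rule Lim_bounded[OF tendsto_norm[OF tendsto_martingale_measure[OF E]]])
  have int: "integrable unit_lebesgue (indicator E :: real \<Rightarrow> real)"
    using E by (intro integrable_indicator_unit_lebesgue) (simp add: sets_unit_lebesgue)
  have "(\<integral>\<omega>. \<bar>indicator E \<omega> :: real\<bar> \<partial>unit_lebesgue) = measure unit_lebesgue E"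
    using E sets.sets_into_space[OF E] by (simp add: Int_absorb2)
  with integrable_scaleR_dyadic(2)[OF int]
  show "\<forall>n\<ge>0. norm (LINT \<omega>:E|unit_lebesgue. x n (dyadic_index n \<omega>)) \<le> K * measure unit_lebesgue E"
    by (simp add: set_lebesgue_integral_def)
qed

lemma martingale_measure_Un:
  assumes A: "A \<in> sets unit_lebesgue" and B: "B \<in> sets unit_lebesgue" and disj: "A \<inter> B = {}"
  shows "martingale_measure (A \<union> B) = martingale_measure A + martingale_measure B"
proof (rule LIMSEQ_unique)
  show "(\<lambda>n. LINT \<omega>:A \<union> B|unit_lebesgue. x n (dyadic_index n \<omega>)) \<longlonglongrightarrow> martingale_measure (A \<union> B)"
    using A B by (intro tendsto_martingale_measure) auto
  have "set_integrable unit_lebesgue E (\<lambda>\<omega>. x n (dyadic_index n \<omega>))" if "E \<in> sets unit_lebesgue" for E n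
    unfolding set_integrable_def
    by (rule integrable_mult_indicator[OF that integrable_dyadic])
  then have "(LINT \<omega>:A \<union> B|unit_lebesgue. x n (dyadic_index n \<omega>))
      = (LINT \<omega>:A|unit_lebesgue. x n (dyadic_index n \<omega>)) + (LINT \<omega>:B|unit_lebesgue. x n (dyadic_index n \<omega>))" for n
    using A B disj by (intro set_integral_Un)
  then show "(\<lambda>n. LINT \<omega>:A \<union> B|unit_lebesgue. x n (dyadic_index n \<omega>))
      \<longlonglongrightarrow> martingale_measure A + martingale_measure B"
    by (simp add: tendsto_add tendsto_martingale_measure A B)
qed

text \<open>By finite additivity the partial sums miss the total by the measure of a tail union. The
  tails decrease to the empty set, so the norm estimate sends this remainder to
  \<open>0\<close>.\<close>

lemma vector_measure_martingale_measure: "vector_measure unit_lebesgue martingale_measure"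
  unfolding vector_measure_def
proof (intro allI impI)
  fix A :: "nat \<Rightarrow> real set"
  assume A: "range A \<subseteq> sets unit_lebesgue" and disj: "disjoint_family A"
  then have Ai: "A i \<in> sets unit_lebesgue" for i by auto
  have tail: "martingale_measure (\<Union>i. A i) = (\<Sum>i<N. martingale_measure (A i)) + martingale_measure (\<Union>i\<in>{N..}. A i)" for N
  proof (induction N)
    case (Suc N)
    have "(\<Union>i\<in>{N..}. A i) = A N \<union> (\<Union>i\<in>{Suc N..}. A i)"
    proof -
      have "{N..} = insert N {Suc N..}" by auto
      then show ?thesis by simp
    qed
    moreover have "A N \<inter> (\<Union>i\<in>{Suc N..}. A i) = {}"
    proof -
      have "A N \<inter> A i = {}" if "i \<ge> Suc N" for i
        using that by (intro disjoint_family_onD[OF disj]) auto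
      then show ?thesis by blast
    qed
    ultimately show ?case
      using Suc martingale_measure_Un[of "A N" "\<Union>i\<in>{Suc N..}. A i"] Ai by (auto simp: add.assoc)
  qed (simp add: lessThan_0)
  have "decseq (\<lambda>N. \<Union>i\<in>{N..}. A i)"
    unfolding decseq_def by (intro allI impI UN_mono) auto
  then have "(\<lambda>N. measure unit_lebesgue (\<Union>i\<in>{N..}. A i)) \<longlonglongrightarrow> measure unit_lebesgue (\<Inter>N. \<Union>i\<in>{N..}. A i)"
    using Ai by (intro U.finite_Lim_measure_decseq) auto
  also have "(\<Inter>N. \<Union>i\<in>{N..}. A i) = {}"
  proof -
    have "\<exists>N. \<omega> \<notin> (\<Union>i\<in>{N..}. A i)" for \<omega>
    proof (cases "\<exists>i. \<omega> \<in> A i")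
      case True
      then obtain i where "\<omega> \<in> A i" by blast
      then have "\<omega> \<notin> A k" if "k \<ge> Suc i" for k
        using disj that unfolding disjoint_family_on_def by (metis Int_iff Suc_n_not_le_n UNIV_I empty_iff)
      then show ?thesis by (intro exI[of _ "Suc i"]) auto
    qed auto
    then show ?thesis by blast
  qed
  finally have "(\<lambda>N. K * measure unit_lebesgue (\<Union>i\<in>{N..}. A i)) \<longlonglongrightarrow> K * 0"
    by (intro tendsto_mult_left) simp
  then have "(\<lambda>N. K * measure unit_lebesgue (\<Union>i\<in>{N..}. A i)) \<longlonglongrightarrow> 0"
    by (simp only: mult_zero_right)
  moreover have "\<forall>\<^sub>F N in sequentially. norm (martingale_measure (\<Union>i\<in>{N..}. A i)) \<le> K * measure unit_lebesgue (\<Union>i\<in>{N..}. A i)"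
    using Ai by (intro always_eventually allI norm_martingale_measure_le) auto
  ultimately have "(\<lambda>N. martingale_measure (\<Union>i\<in>{N..}. A i)) \<longlonglongrightarrow> 0"
    by (rule Lim_null_comparison[rotated])
  then have "(\<lambda>N. martingale_measure (\<Union>i. A i) - martingale_measure (\<Union>i\<in>{N..}. A i))
      \<longlonglongrightarrow> martingale_measure (\<Union>i. A i) - 0"
    by (intro tendsto_diff tendsto_const)
  moreover have "martingale_measure (\<Union>i. A i) - martingale_measure (\<Union>i\<in>{N..}. A i)
      = (\<Sum>i<N. martingale_measure (A i))" for N
    using tail[of N] by simp
  ultimately show "(\<lambda>n. martingale_measure (A n)) sums martingale_measure (\<Union>n. A n)"
    by (simp add: sums_def)
qed

text \<open>With the indicator of the cell as test function,
  \<open>integral_dyadic_martingale\<close> makes the defining sequence constant from level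
  \<open>n\<close> on.\<close>

lemma martingale_measure_dyadic:
  assumes k: "k < 2 ^ n"
  shows "martingale_measure {\<omega> \<in> {0..<1}. dyadic_index n \<omega> = k} = (1 / 2 ^ n) *\<^sub>R x n k"
proof (rule LIMSEQ_unique)
  let ?D = "{\<omega> \<in> {0..<1}. dyadic_index n \<omega> = k}"
  have "{\<omega> \<in> space unit_lebesgue. dyadic_index n \<omega> = k} \<in> sets unit_lebesgue" by measurable
  then show "(\<lambda>j. LINT \<omega>:?D|unit_lebesgue. x j (dyadic_index j \<omega>)) \<longlonglongrightarrow> martingale_measure ?D"
    by (intro tendsto_martingale_measure) simp
  define F :: "nat \<Rightarrow> real" where "F i = (if i = k then 1 else 0)" for i
  have "(LINT \<omega>:?D|unit_lebesgue. x j (dyadic_index j \<omega>)) = (1 / 2 ^ n) *\<^sub>R x n k" if "j \<ge> n" for j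
  proof -
    obtain i where j: "j = n + i" using \<open>j \<ge> n\<close> le_Suc_ex by blast
    have "(LINT \<omega>:?D|unit_lebesgue. x j (dyadic_index j \<omega>))
        = (\<integral>\<omega>. F (dyadic_index n \<omega>) *\<^sub>R x (n + i) (dyadic_index (n + i) \<omega>) \<partial>unit_lebesgue)"
      unfolding set_lebesgue_integral_def j
      by (rule Bochner_Integration.integral_cong) (auto simp: F_def)
    also have "\<dots> = (\<integral>\<omega>. F (dyadic_index n \<omega>) *\<^sub>R x n (dyadic_index n \<omega>) \<partial>unit_lebesgue)"
      by (rule integral_dyadic_martingale)
    also have "\<dots> = (\<Sum>i<2 ^ n. (1 / 2 ^ n) *\<^sub>R (F i *\<^sub>R x n i))"
      by (rule integral_dyadic)
    also have "\<dots> = (\<Sum>i<2 ^ n. if i = k then (1 / 2 ^ n) *\<^sub>R x n k else 0)"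
      by (intro sum.cong) (auto simp: F_def)
    finally show ?thesis using k by simp
  qed
  then show "(\<lambda>j. LINT \<omega>:?D|unit_lebesgue. x j (dyadic_index j \<omega>)) \<longlonglongrightarrow> (1 / 2 ^ n) *\<^sub>R x n k"
    by (intro tendsto_eventually) (auto simp: eventually_sequentially)
qed

text \<open>The approximating integrals are finite linear combinations of martingale values, and
  \<open>Y\<close> is closed.\<close>

lemma martingale_measure_in_subspace:
  assumes Y: "subspace Y" "closed Y" and x: "\<And>n k. x n k \<in> Y" and E: "E \<in> sets unit_lebesgue"
  shows "martingale_measure E \<in> Y"
proof (rule closed_sequentially[OF Y(2) _ tendsto_martingale_measure[OF E]])
  show "(LINT \<omega>:E|unit_lebesgue. x n (dyadic_index n \<omega>)) \<in> Y" for n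
    unfolding set_integral_dyadic[OF E] using Y(1) x by (intro subspace_sum subspace_scale)
qed

lemma martingale_measure_continuous: "continuous_wrt_measure unit_lebesgue martingale_measure"
  unfolding continuous_wrt_measure_def
proof (intro allI impI)
  fix e :: real assume e: "e > 0"
  have K0: "K \<ge> 0" using bounded[of 0 0] norm_ge_zero order_trans by blast
  have "norm (martingale_measure E) < e" if "E \<in> sets unit_lebesgue" "measure unit_lebesgue E < e / (K + 1)" for E
  proof -
    have "norm (martingale_measure E) \<le> K * measure unit_lebesgue E"
      by (rule norm_martingale_measure_le[OF that(1)])
    also have "\<dots> \<le> (K + 1) * measure unit_lebesgue E"
      by (intro mult_right_mono) auto
    also have "\<dots> < e" using that(2) K0 by (simp add: field_simps)
    finally show ?thesis .
  qed
  moreover have "e / (K + 1) > 0" using e K0 by simp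
  ultimately show "\<exists>d>0. \<forall>E\<in>sets unit_lebesgue. measure unit_lebesgue E < d \<longrightarrow> norm (martingale_measure E) < e"
    by blast
qed

lemma martingale_measure_bounded_variation: "bounded_variation_wrt unit_lebesgue martingale_measure"
  unfolding bounded_variation_wrt_def
proof (intro exI allI impI)
  fix P assume P: "finite P" "P \<subseteq> sets unit_lebesgue" "partition_on (space unit_lebesgue) P"
  have "(\<Sum>E\<in>P. norm (martingale_measure E)) \<le> (\<Sum>E\<in>P. K * measure unit_lebesgue E)"
    using P(2) norm_martingale_measure_le by (intro sum_mono) blast
  also have "\<dots> = K * (\<Sum>E\<in>P. measure unit_lebesgue E)"
    by (simp add: sum_distrib_left)
  also have "(\<Sum>E\<in>P. measure unit_lebesgue E) = measure unit_lebesgue (\<Union>E\<in>P. E)"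
    using P by (intro U.finite_measure_finite_Union[symmetric])
      (auto simp: partition_on_def disjoint_def disjoint_family_on_def)
  also have "\<dots> = 1"
    using P(3) measure_space_unit_lebesgue by (simp add: partition_on_def)
  finally show "(\<Sum>E\<in>P. norm (martingale_measure E)) \<le> K * 1" .
qed

text \<open>The mean of \<open>g\<close> over cell \<open>k\<close> is \<open>x n k\<close>, and
  taking means over cells does not increase L1 norms, so \<open>c\<close> is at most as far from the
  martingale as from \<open>g\<close>. The triangle inequality through \<open>c\<close> gives the
  factor \<open>2\<close>.\<close>

lemma martingale_density_dist:
  assumes g: "integrable unit_lebesgue g"
    and density: "\<And>E. E \<in> sets unit_lebesgue \<Longrightarrow> martingale_measure E = (LINT \<omega>:E|unit_lebesgue. g \<omega>)"
  shows "(\<integral>\<omega>. norm (g \<omega> - x n (dyadic_index n \<omega>)) \<partial>unit_lebesgue)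
    \<le> 2 * (\<integral>\<omega>. norm (g \<omega> - c (dyadic_index n \<omega>)) \<partial>unit_lebesgue)"
proof -
  let ?D = "\<lambda>k. {\<omega> \<in> {0..<1}. dyadic_index n \<omega> = k}"
  let ?gc = "\<lambda>\<omega>. g \<omega> - c (dyadic_index n \<omega>)"
  have D: "?D k \<in> sets unit_lebesgue" for k
  proof -
    have "{\<omega> \<in> space unit_lebesgue. dyadic_index n \<omega> = k} \<in> sets unit_lebesgue" by measurable
    then show ?thesis by simp
  qed
  have gc: "integrable unit_lebesgue ?gc" by (intro Bochner_Integration.integrable_diff g integrable_dyadic)
  have cx: "integrable unit_lebesgue (\<lambda>\<omega>. c (dyadic_index n \<omega>) - x n (dyadic_index n \<omega>))"
    by (rule Bochner_Integration.integrable_diff[OF integrable_dyadic integrable_dyadic])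
  have cell: "(1 / 2 ^ n) * norm (c k - x n k) \<le> (\<integral>\<omega>. indicator (?D k) \<omega> * norm (?gc \<omega>) \<partial>unit_lebesgue)"
    if k: "k < 2 ^ n" for k
  proof -
    have "(LINT \<omega>:?D k|unit_lebesgue. c (dyadic_index n \<omega>)) = (\<integral>\<omega>. indicator (?D k) \<omega> *\<^sub>R c k \<partial>unit_lebesgue)"
      unfolding set_lebesgue_integral_def by (rule Bochner_Integration.integral_cong) (auto simp: indicator_def)
    also have "\<dots> = (1 / 2 ^ n) *\<^sub>R c k"
      by (simp only: integral_indicator_scaleR[OF D] measure_dyadic_index[OF k])
    finally have c: "(LINT \<omega>:?D k|unit_lebesgue. c (dyadic_index n \<omega>)) = (1 / 2 ^ n) *\<^sub>R c k" .
    have "(1 / 2 ^ n) *\<^sub>R (x n k - c k) = (LINT \<omega>:?D k|unit_lebesgue. g \<omega>) - (LINT \<omega>:?D k|unit_lebesgue. c (dyadic_index n \<omega>))"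
      using density[OF D] martingale_measure_dyadic[OF k] c by (simp add: scaleR_diff_right)
    also have "\<dots> = (LINT \<omega>:?D k|unit_lebesgue. ?gc \<omega>)"
      by (rule set_integral_diff(2)[symmetric])
        (use D g integrable_dyadic in \<open>auto simp: set_integrable_def intro!: integrable_mult_indicator\<close>)
    finally have "(1 / 2 ^ n) * norm (c k - x n k) = norm (LINT \<omega>:?D k|unit_lebesgue. ?gc \<omega>)"
      by (metis abs_of_nonneg norm_minus_commute norm_scaleR zero_le_divide_1_iff zero_le_numeral zero_le_power)
    also have "\<dots> \<le> (\<integral>\<omega>. norm (indicator (?D k) \<omega> *\<^sub>R ?gc \<omega>) \<partial>unit_lebesgue)"
      unfolding set_lebesgue_integral_def by (rule integral_norm_bound)
    finally show ?thesis by simp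
  qed
  have "(\<integral>\<omega>. norm (c (dyadic_index n \<omega>) - x n (dyadic_index n \<omega>)) \<partial>unit_lebesgue)
      = (\<Sum>k<2 ^ n. (1 / 2 ^ n) * norm (c k - x n k))"
    using integral_dyadic[of "\<lambda>k. norm (c k - x n k)" n] by simp
  also have "\<dots> \<le> (\<Sum>k<2 ^ n. (\<integral>\<omega>. indicator (?D k) \<omega> * norm (?gc \<omega>) \<partial>unit_lebesgue))"
    by (intro sum_mono cell) simp
  also have "\<dots> = (\<integral>\<omega>. (\<Sum>k<2 ^ n. indicator (?D k) \<omega> * norm (?gc \<omega>)) \<partial>unit_lebesgue)"
    using integrable_mult_indicator[OF D integrable_norm[OF gc]]
    by (intro Bochner_Integration.integral_sum[symmetric]) simp
  also have "\<dots> = (\<integral>\<omega>. norm (?gc \<omega>) \<partial>unit_lebesgue)"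
  proof (rule Bochner_Integration.integral_cong[OF refl])
    fix \<omega> assume \<omega>: "\<omega> \<in> space unit_lebesgue"
    then have "dyadic_index n \<omega> < 2 ^ n" using dyadic_index_less by simp
    then have "norm (?gc \<omega>) = (\<Sum>k<2 ^ n. if k = dyadic_index n \<omega> then norm (?gc \<omega>) else 0)"
      by (simp only: sum.delta' sum.delta finite_lessThan lessThan_iff if_True)
    also have "\<dots> = (\<Sum>k<2 ^ n. indicator (?D k) \<omega> * norm (?gc \<omega>))"
      using \<omega> by (intro sum.cong) (auto simp: indicator_def)
    finally show "(\<Sum>k<2 ^ n. indicator (?D k) \<omega> * norm (?gc \<omega>)) = norm (?gc \<omega>)" ..
  qed
  finally have cx_le: "(\<integral>\<omega>. norm (c (dyadic_index n \<omega>) - x n (dyadic_index n \<omega>)) \<partial>unit_lebesgue)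
      \<le> (\<integral>\<omega>. norm (?gc \<omega>) \<partial>unit_lebesgue)" .
  have "(\<integral>\<omega>. norm (g \<omega> - x n (dyadic_index n \<omega>)) \<partial>unit_lebesgue)
      \<le> (\<integral>\<omega>. norm (?gc \<omega>) + norm (c (dyadic_index n \<omega>) - x n (dyadic_index n \<omega>)) \<partial>unit_lebesgue)"
  proof (rule integral_mono)
    show "norm (g \<omega> - x n (dyadic_index n \<omega>)) \<le> norm (?gc \<omega>) + norm (c (dyadic_index n \<omega>) - x n (dyadic_index n \<omega>))" for \<omega>
      by (rule norm_diff_triangle_le[OF order_refl order_refl])
  qed (intro Bochner_Integration.integrable_add integrable_norm Bochner_Integration.integrable_diff g integrable_dyadic)+
  also have "\<dots> = (\<integral>\<omega>. norm (?gc \<omega>) \<partial>unit_lebesgue)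
      + (\<integral>\<omega>. norm (c (dyadic_index n \<omega>) - x n (dyadic_index n \<omega>)) \<partial>unit_lebesgue)"
    by (intro Bochner_Integration.integral_add integrable_norm gc cx)
  finally show ?thesis using cx_le by simp
qed

text \<open>A step function of level \<open>m\<close> close to \<open>g\<close> is also a step
  function of each level \<open>m + j\<close>, so the preceding estimate applies at all these
  levels.\<close>

lemma martingale_tendsto_density:
  assumes g: "integrable unit_lebesgue g"
    and density: "\<And>E. E \<in> sets unit_lebesgue \<Longrightarrow> martingale_measure E = (LINT \<omega>:E|unit_lebesgue. g \<omega>)"
  shows "(\<lambda>n. \<integral>\<omega>. norm (g \<omega> - x n (dyadic_index n \<omega>)) \<partial>unit_lebesgue) \<longlonglongrightarrow> 0"
proof (rule LIMSEQ_I)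
  fix e :: real assume "e > 0"
  then have "e / 2 > 0" by simp
  then obtain m F where F: "(\<integral>\<omega>. norm (g \<omega> - F (dyadic_index m \<omega>)) \<partial>unit_lebesgue) < e / 2"
    using integrable_imp_dyadic_approximable[OF g] unfolding dyadic_approximable_def by blast
  have "(\<integral>\<omega>. norm (g \<omega> - x n (dyadic_index n \<omega>)) \<partial>unit_lebesgue) < e" if "n \<ge> m" for n
  proof -
    obtain j where n: "n = m + j" using \<open>n \<ge> m\<close> le_Suc_ex by blast
    show ?thesis
      using martingale_density_dist[OF g density, of n "\<lambda>k. F (k div 2 ^ j)"] F
      unfolding n dyadic_index_add_div by simp
  qed
  then show "\<exists>m. \<forall>n\<ge>m. norm ((\<integral>\<omega>. norm (g \<omega> - x n (dyadic_index n \<omega>)) \<partial>unit_lebesgue) - 0) < e"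
    by (intro exI[of _ m]) (simp add: integral_nonneg)
qed

end

lemma radon_nikodym_martingale_converges:
  fixes x :: "nat \<Rightarrow> nat \<Rightarrow> 'a::{banach, second_countable_topology}"
  assumes Y: "subspace Y" "closed Y" "radon_nikodym_property Y"
    and xY: "\<And>n k. x n k \<in> Y"
    and martingale: "\<And>n k. x (Suc n) (2 * k) + x (Suc n) (2 * k + 1) = 2 *\<^sub>R x n k"
    and bounded: "\<And>n k. norm (x n k) \<le> K"
  obtains g where "integrable unit_lebesgue g"
    "(\<lambda>n. \<integral>\<omega>. norm (g \<omega> - x n (dyadic_index n \<omega>)) \<partial>unit_lebesgue) \<longlonglongrightarrow> 0"
proof -
  note mb = martingale bounded
  have "\<exists>g. integrable unit_lebesgue g \<and> (\<forall>\<omega>\<in>space unit_lebesgue. g \<omega> \<in> Y) \<and>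
      (\<forall>E\<in>sets unit_lebesgue. martingale_measure x E = (LINT \<omega>:E|unit_lebesgue. g \<omega>))"
    using Y(3) finite_measure_unit_lebesgue vector_measure_martingale_measure[of x K, OF mb]
      martingale_measure_continuous[of x K, OF mb] martingale_measure_bounded_variation[of x K, OF mb]
      martingale_measure_in_subspace[of x K, OF mb Y(1,2) xY]
    unfolding radon_nikodym_property_def by blast
  then obtain g where g: "integrable unit_lebesgue g"
    and density: "\<And>E. E \<in> sets unit_lebesgue \<Longrightarrow> martingale_measure x E = (LINT \<omega>:E|unit_lebesgue. g \<omega>)"
    by blast
  show thesis
    by (rule that[OF g martingale_tendsto_density[of x K, OF mb g density]])
qed

section \<open>The martingale of almost maximal perturbations\<close>

primrec perturbation_tree :: "('a::real_vector \<Rightarrow> 'a) \<Rightarrow> 'a \<Rightarrow> nat \<Rightarrow> nat \<Rightarrow> 'a" where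
  "perturbation_tree y a 0 k = a"
| "perturbation_tree y a (Suc n) k = (let p = perturbation_tree y a n (k div 2)
    in if even k then p + y p else p - y p)"

text \<open>Since \<open>v = (x + v) - x\<close>, boundedness of \<open>C\<close> bounds the
  admissible \<open>v\<close>. Some \<open>y\<close> exceeds half the supremum of their norms,
  unless the supremum is \<open>0\<close>, where \<open>y = 0\<close> serves.\<close>

lemma almost_maximal_perturbation:
  fixes C :: "'a::real_normed_vector set"
  assumes C: "bounded C" and x: "x \<in> C"
  obtains y where "x + y \<in> C" "x - y \<in> C"
    "\<And>v. x + v \<in> C \<Longrightarrow> x - v \<in> C \<Longrightarrow> norm v \<le> 2 * norm y"
proof -
  let ?V = "{v. x + v \<in> C \<and> x - v \<in> C}"
  obtain b where b: "\<And>x. x \<in> C \<Longrightarrow> norm x \<le> b" using C by (auto simp: bounded_iff)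
  have "norm v \<le> b + b" if "v \<in> ?V" for v
    using norm_triangle_ineq4[of "x + v" x] b[of "x + v"] b[OF x] that by simp
  then have bdd: "bdd_above (norm ` ?V)" by (auto intro!: bdd_aboveI2)
  have "0 \<in> ?V" using x by simp
  define s where "s = (SUP v\<in>?V. norm v)"
  have s: "norm v \<le> s" if "v \<in> ?V" for v
    unfolding s_def by (rule cSUP_upper[OF that bdd])
  show thesis
  proof (cases "s = 0")
    case True
    with that[of 0] s x show thesis by auto
  next
    case False
    with s[OF \<open>0 \<in> ?V\<close>] have "s / 2 < s" by simp
    then obtain y where "y \<in> ?V" "s / 2 < norm y"
      using less_cSUP_iff[OF _ bdd, of "s / 2"] \<open>0 \<in> ?V\<close> unfolding s_def by blast
    with that[of y] s show thesis by fastforce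
  qed
qed

text \<open>The martingale increment at a point is at least half as long as every admissible
  perturbation there. So wherever \<open>g\<close> is near \<open>z\<close>, either the martingale
  is away from \<open>g\<close> or two consecutive values are at least \<open>norm v / 2\<close>
  apart; as both L1 distances to \<open>g\<close> tend to \<open>0\<close>, this happens only on a
  null set.\<close>

theorem radon_nikodym_imp_not_perturbable:
  fixes Y C :: "'a::{banach, second_countable_topology} set"
  assumes Y: "subspace Y" "closed Y" "radon_nikodym_property Y"
    and C: "C \<subseteq> Y" "bounded C" "a \<in> C"
    and perturb: "\<And>z. \<exists>d>0. \<exists>v. v \<noteq> 0 \<and> (\<forall>x\<in>C. dist x z < d \<longrightarrow> x + v \<in> C \<and> x - v \<in> C)"
  shows False
proof -
  have "\<forall>x. \<exists>y. x \<in> C \<longrightarrow> x + y \<in> C \<and> x - y \<in> C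
      \<and> (\<forall>v. x + v \<in> C \<longrightarrow> x - v \<in> C \<longrightarrow> norm v \<le> 2 * norm y)"
    using almost_maximal_perturbation[OF C(2)] by metis
  then obtain y where y: "\<And>x. x \<in> C \<Longrightarrow> x + y x \<in> C" "\<And>x. x \<in> C \<Longrightarrow> x - y x \<in> C"
    and ymax: "\<And>x v. x \<in> C \<Longrightarrow> x + v \<in> C \<Longrightarrow> x - v \<in> C \<Longrightarrow> norm v \<le> 2 * norm (y x)"
    by metis
  \<comment> \<open>\<open>x n k\<close> is the value on cell \<open>k\<close> of level
    \<open>n\<close>; the halves \<open>2 * k\<close> and \<open>2 * k + 1\<close> of that cell
    carry the two signs of the perturbation.\<close>
  define x where "x = perturbation_tree y a"
  have xC: "x n k \<in> C" for n k
    unfolding x_def by (induction n arbitrary: k) (use C(3) y in \<open>auto simp: Let_def\<close>)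
  have martingale: "x (Suc n) (2 * k) + x (Suc n) (2 * k + 1) = 2 *\<^sub>R x n k" for n k
    by (simp add: x_def Let_def scaleR_2)
  have diff: "norm (x (Suc n) k - x n (k div 2)) = norm (y (x n (k div 2)))" for n k
    by (simp add: x_def Let_def)
  obtain K where K: "\<And>x. x \<in> C \<Longrightarrow> norm x \<le> K" using C(2) by (auto simp: bounded_iff)
  obtain g where g: "integrable unit_lebesgue g"
    and lim: "(\<lambda>n. \<integral>\<omega>. norm (g \<omega> - x n (dyadic_index n \<omega>)) \<partial>unit_lebesgue) \<longlonglongrightarrow> 0"
    by (rule radon_nikodym_martingale_converges[where x = x and K = K, OF Y])
      (use C(1) xC K martingale in blast)+
  define e where "e n = (\<integral>\<omega>. norm (g \<omega> - x n (dyadic_index n \<omega>)) \<partial>unit_lebesgue)" for n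
  have dist_int: "integrable unit_lebesgue (\<lambda>\<omega>. norm (g \<omega> - x n (dyadic_index n \<omega>)))" for n
    by (intro integrable_norm Bochner_Integration.integrable_diff g integrable_dyadic)
  have gm: "g \<in> borel_measurable unit_lebesgue" using g by auto
  have null: "\<exists>d>0. g -` ball z d \<inter> {0..<1} \<in> null_sets unit_lebesgue" for z
  proof -
    obtain d v where d: "d > 0" and v: "v \<noteq> 0"
      and pert: "\<And>x. x \<in> C \<Longrightarrow> dist x z < d \<Longrightarrow> x + v \<in> C \<and> x - v \<in> C"
      using perturb by metis
    \<comment> \<open>Half the radius: if the martingale is within \<open>d / 2\<close> of
      \<open>g \<omega>\<close>, it is within \<open>d\<close> of \<open>z\<close>.\<close>
    let ?A = "g -` ball z (d / 2) \<inter> {0..<1}"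
    have A: "?A \<in> sets unit_lebesgue"
      using measurable_sets[OF gm, of "ball z (d / 2)"] by simp
    \<comment> \<open>Factors for a Markov estimate: \<open>s\<close> normalizes a distance of at
      least \<open>d / 2\<close>, and \<open>t\<close> a sum of two consecutive distances of at
      least \<open>norm v / 2\<close>.\<close>
    define s t where "s = 2 / d" and "t = 2 / norm v"
    have st: "s > 0" "t > 0" using d v by (auto simp: s_def t_def)
    have "measure unit_lebesgue ?A \<le> (s + t) * e n + t * e (Suc n)" for n
    proof -
      have pointwise: "indicator ?A \<omega> \<le> (s + t) * norm (g \<omega> - x n (dyadic_index n \<omega>))
          + t * norm (g \<omega> - x (Suc n) (dyadic_index (Suc n) \<omega>))" for \<omega>
      proof (cases "\<omega> \<in> ?A")
        case True
        let ?p = "norm (g \<omega> - x n (dyadic_index n \<omega>))" and ?q = "norm (g \<omega> - x (Suc n) (dyadic_index (Suc n) \<omega>))"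
        have "1 \<le> (s + t) * ?p + t * ?q"
        proof (cases "?p < d / 2")
          case False
          then have "1 \<le> s * ?p" using d by (simp add: s_def field_simps)
          moreover have "0 \<le> t * ?p" "0 \<le> t * ?q" using st by auto
          ultimately show ?thesis by (simp add: distrib_right)
        next
          case p: True
          have "dist (x n (dyadic_index n \<omega>)) z < d"
            using dist_triangle_half_r[of "g \<omega>" "x n (dyadic_index n \<omega>)" d z] p True
            by (simp add: dist_norm norm_minus_commute)
          then have "norm v \<le> 2 * norm (y (x n (dyadic_index n \<omega>)))"
            using ymax[OF xC] pert[OF xC] by blast
          also have "norm (y (x n (dyadic_index n \<omega>))) = norm (x (Suc n) (dyadic_index (Suc n) \<omega>) - x n (dyadic_index n \<omega>))"
            using diff[of n "dyadic_index (Suc n) \<omega>"] by (simp add: dyadic_index_Suc_div)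
          also have "\<dots> \<le> ?q + ?p"
            by (rule norm_diff_triangle_le[where y = "g \<omega>"]) (simp_all add: norm_minus_commute)
          finally have "norm v \<le> 2 * (?q + ?p)" by simp
          then have "1 \<le> t * (?q + ?p)" using v by (simp add: t_def field_simps)
          moreover have "0 \<le> s * ?p" using st by auto
          ultimately show ?thesis by (simp add: algebra_simps)
        qed
        with True show ?thesis by simp
      qed (use st in simp)
      have "measure unit_lebesgue ?A = (\<integral>\<omega>. indicator ?A \<omega> \<partial>unit_lebesgue)"
        using sets.sets_into_space[OF A] by (simp add: Int_absorb2)
      also have "\<dots> \<le> (\<integral>\<omega>. (s + t) * norm (g \<omega> - x n (dyadic_index n \<omega>))
          + t * norm (g \<omega> - x (Suc n) (dyadic_index (Suc n) \<omega>)) \<partial>unit_lebesgue)"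
      proof (rule integral_mono[OF _ _ pointwise])
        show "integrable unit_lebesgue (indicator ?A :: real \<Rightarrow> real)"
          using A by (intro integrable_indicator_unit_lebesgue) (simp add: sets_unit_lebesgue)
      qed (intro Bochner_Integration.integrable_add integrable_mult_right dist_int)
      also have "\<dots> = (s + t) * e n + t * e (Suc n)"
        unfolding e_def using dist_int by (subst Bochner_Integration.integral_add) auto
      finally show ?thesis .
    qed
    moreover have "(\<lambda>n. (s + t) * e n + t * e (Suc n)) \<longlonglongrightarrow> (s + t) * 0 + t * 0"
      using lim LIMSEQ_Suc[OF lim] unfolding e_def by (intro tendsto_intros)
    ultimately have "measure unit_lebesgue ?A \<le> (s + t) * 0 + t * 0"
      by (intro LIMSEQ_le_const) auto
    then have "emeasure unit_lebesgue ?A = 0"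
      by (simp add: U.emeasure_eq_measure measure_le_0_iff)
    with A d show ?thesis by (intro exI[of _ "d / 2"]) (auto simp: null_sets_def)
  qed
  then obtain d where d: "\<And>z. d z > 0" "\<And>z. g -` ball z (d z) \<inter> {0..<1} \<in> null_sets unit_lebesgue"
    by metis
  \<comment> \<open>Countably many of the balls cover the space, so their null preimages under
    \<open>g\<close> cover the whole unit interval.\<close>
  obtain \<F> where \<F>: "\<F> \<subseteq> range (\<lambda>z. ball z (d z))" "countable \<F>" "\<Union>\<F> = \<Union>(range (\<lambda>z. ball z (d z)))"
    by (rule Lindelof[of "range (\<lambda>z. ball z (d z))"]) auto
  have "z \<in> \<Union>\<F>" for z
    unfolding \<F>(3) using d(1)[of z] by (intro UN_I[of z]) auto
  then have "{0..<1} = (\<Union>B\<in>\<F>. g -` B \<inter> {0..<1})" by auto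
  moreover have "(\<Union>B\<in>\<F>. g -` B \<inter> {0..<1}) \<in> null_sets unit_lebesgue"
    using \<F>(1) d(2) by (intro null_sets_UN' \<F>(2)) auto
  ultimately have "emeasure unit_lebesgue {0..<1} = 0" by (metis null_setsD1)
  then show False
    using measure_space_unit_lebesgue by (simp add: measure_def)
qed

(* For a normed space, the class second_countable_topology is exactly separability. *)
theorem corollary5:
  fixes Y F :: "'a::{banach, second_countable_topology} set"
  assumes "infinite_dimensional (UNIV :: 'a set)"
    and "subspace Y" and "closed Y" and "infinite_dimensional Y"
    and "radon_nikodym_property Y"
    and "bounded F" and "closed F" and "convex F" and "0 \<in> interior F"
  shows "uncountable (weak_star_exposed (polar F))"
proof
  assume "countable (weak_star_exposed (polar F))"
  then obtain C where "C \<subseteq> Y" "bounded C" "0 \<in> C"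
    and "\<And>z. \<exists>d>0. \<exists>v. v \<noteq> 0 \<and> (\<forall>x\<in>C. dist x z < d \<longrightarrow> x + v \<in> C \<and> x - v \<in> C)"
    using countable_weak_star_exposed_imp_perturbable[OF assms(6,9,2,4)] by metis
  then show False
    by (rule radon_nikodym_imp_not_perturbable[OF assms(2,3,5)])
qed

end
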